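(* There is an absolute constant $C>0$ such that the following holds. Let $n>2$, $\sigma>0$, and let $\bar a_1,\dots,\bar a_n\in\mathbb R^2$ have Euclidean norm at most $1$. For each $i\in[n]$ let $a_i\sim\mathcal N_2(\bar a_i,\sigma^2 I)$, independently. Then \[ \mathbb E\big[\operatorname{edges}(\operatorname{conv}(a_1,\dots,a_n))\big]\leq C\Big(\frac{\sqrt[4]{\log n}}{\sqrt\sigma}+\sqrt{\log n}\Big). \]
   Context: $\mathcal N_2(\bar a,\sigma^2 I)$ is the two-dimensional Gaussian with mean $\bar a$ and covariance $\sigma^2 I$. $\operatorname{edges}(T)$ is the number of edges of the polygon $T$. The $O(\cdot)$ is interpreted as an absolute constant $C$. *)

theory Defs
  imports "HOL-Probability.Probability"
begin

definition gauss2 :: "real ^ 2 \<Rightarrow> real \<Rightarrow> (real ^ 2) measure" where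
  "gauss2 \<mu> \<sigma> = density lborel
     (\<lambda>x. ennreal (exp (- (norm (x - \<mu>))\<^sup>2 / (2 * \<sigma>\<^sup>2)) / (2 * pi * \<sigma>\<^sup>2)))"

text \<open>
  If \<open>T\<close> is contained in a line, then \<open>T\<close> itself may count as an edge.  For three or more
  independent points with law \<^const>\<open>gauss2\<close> this happens with probability 0.
\<close>

definition num_edges :: "(real ^ 2) set \<Rightarrow> nat" where
  "num_edges T = card {e. e edge_of T}"

lemma gauss2_density_eq_prod:
  assumes "\<sigma> > 0"
  shows "exp (- (norm (x - \<mu>))\<^sup>2 / (2 * \<sigma>\<^sup>2)) / (2 * pi * \<sigma>\<^sup>2) =
    (\<Prod>b\<in>Basis. normal_density (\<mu> \<bullet> b) \<sigma> ((x :: real ^ 2) \<bullet> b))"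
proof -
  have "(\<Prod>b\<in>Basis. normal_density (\<mu> \<bullet> b) \<sigma> (x \<bullet> b)) =
      (1 / sqrt (2 * pi * \<sigma>\<^sup>2)) ^ 2 * exp (\<Sum>b\<in>Basis. - (x \<bullet> b - \<mu> \<bullet> b)\<^sup>2 / (2 * \<sigma>\<^sup>2))"
    by (simp add: normal_density_def prod.distrib exp_sum prod_dividef power_divide)
  also have "(\<Sum>b\<in>Basis. - (x \<bullet> b - \<mu> \<bullet> b)\<^sup>2 / (2 * \<sigma>\<^sup>2)) = - (norm (x - \<mu>))\<^sup>2 / (2 * \<sigma>\<^sup>2)"
    unfolding power2_norm_eq_inner
    by (subst euclidean_inner)
       (simp add: sum_negf inner_diff_left power2_eq_square flip: sum_divide_distrib)
  finally show ?thesis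
    by (simp add: power_divide)
qed

lemma prob_space_gauss2:
  assumes "\<sigma> > 0"
  shows "prob_space (gauss2 \<mu> \<sigma>)"
proof
  have one: "(\<integral>\<^sup>+x. ennreal (normal_density m \<sigma> x) \<partial>lborel) = 1" for m
    using integral_normal_density[OF assms, of m] integrable_normal_density[OF assms, of m]
    by (subst nn_integral_eq_integral) auto
  show "emeasure (gauss2 \<mu> \<sigma>) (space (gauss2 \<mu> \<sigma>)) = 1"
    unfolding gauss2_def gauss2_density_eq_prod[OF assms]
    using nn_integral_lborel_prod[of "\<lambda>b x. ennreal (normal_density (\<mu> \<bullet> b) \<sigma> x)"]
    by (simp add: emeasure_density prod_ennreal[symmetric] one)
qed

text \<open>
  Independent Gaussian random vectors on an arbitrary probability space have the product of
  the measures \<^const>\<open>gauss2\<close> as their joint law.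
\<close>

lemma (in prob_space) joint_law_gauss2:
  fixes a :: "nat \<Rightarrow> 'a \<Rightarrow> real ^ 2"
  assumes "n \<ge> 1" "indep_vars (\<lambda>_. borel) a {1..n}"
    and "\<And>i. i \<in> {1..n} \<Longrightarrow> distr M borel (a i) = gauss2 (abar i) \<sigma>"
  shows "distr M (\<Pi>\<^sub>M i\<in>{1..n}. borel) (\<lambda>\<omega>. \<lambda>i\<in>{1..n}. a i \<omega>) =
    (\<Pi>\<^sub>M i\<in>{1..n}. gauss2 (abar i) \<sigma>)"
proof -
  have "distr M (\<Pi>\<^sub>M i\<in>{1..n}. borel) (\<lambda>\<omega>. \<lambda>i\<in>{1..n}. a i \<omega>) =
      (\<Pi>\<^sub>M i\<in>{1..n}. distr M borel (a i))"
    using assms(1,2) by (subst indep_vars_iff_distr_eq_PiM'[symmetric]) (auto simp: indep_vars_def)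
  also have "\<dots> = (\<Pi>\<^sub>M i\<in>{1..n}. gauss2 (abar i) \<sigma>)"
    by (intro PiM_cong assms(3)) auto
  finally show ?thesis .
qed

end

theory Submission
  imports Defs
begin

text \<open>
  Call an edge of the hull gapped if all remaining points have distance at least
  \<open>\<tau> = \<sigma> / R\<close> from its line, where \<open>R = sqrt (12 ln n)\<close>.

  Given two points \<open>x, y\<close> with unit normal \<open>w\<close>, the map \<open>(x, y) \<mapsto> (x + \<tau> w, y + \<tau> w)\<close> is a shear in
  the coordinates \<open>(x, y - x)\<close>, hence preserves Lebesgue measure. It turns edges into gapped edges,
  and it changes the Gaussian densities by at most a constant factor as long as \<open>x\<close> and \<open>y\<close> are
  within \<open>R \<sigma>\<close> of their means. Up to negligible tails, the expected number of edges is therefore at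
  most a constant times the expected number of gapped edges.

  The number of gapped edges is bounded deterministically: for two of them, with unit normals
  \<open>w, w'\<close> and starting points \<open>p, p'\<close>, one has \<open>(w - w') \<bullet> (p - p') \<ge> \<tau>\<close>, while along the hull the
  total variation of \<open>w\<close> is \<open>O(1)\<close> and that of \<open>p\<close> is \<open>O(D)\<close> if all points have norm at most
  \<open>D\<close>. Hence there are at most \<open>O(1 + sqrt (D / \<tau>))\<close> of them, and \<open>D = 1 + R \<sigma>\<close> gives the claim.
\<close>

section \<open>Edges of planar convex hulls\<close>

definition perp :: "real ^ 2 \<Rightarrow> real ^ 2" where
  "perp d = vector [- (d $ 2), d $ 1]"

lemma inner_vec2: "x \<bullet> y = x $ 1 * y $ 1 + x $ 2 * (y::real^2) $ 2"
  by (simp add: inner_vec_def sum_2)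

lemma norm_vec2_sq: "(norm (x :: real ^ 2))\<^sup>2 = (x $ 1)\<^sup>2 + (x $ 2)\<^sup>2"
  unfolding power2_norm_eq_inner inner_vec2 by (simp add: power2_eq_square)

lemma perp_nth [simp]: "perp d $ 1 = - (d $ 2)" "perp d $ 2 = d $ 1"
  by (simp_all add: perp_def)

text \<open>The right-hand side is the determinant of \<open>d\<close> and \<open>v\<close>: it is
  positive exactly when \<open>v\<close> points to the left of \<open>d\<close>.\<close>

lemma inner_perp: "perp d \<bullet> v = d $ 1 * v $ 2 - d $ 2 * v $ 1"
  by (simp add: inner_vec2)

lemma norm_perp [simp]: "norm (perp d) = norm d"
  by (simp add: norm_eq_sqrt_inner inner_vec2)

lemma perp_minus: "perp (- d) = - perp d"
  by (simp add: vec_eq_iff forall_2)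

lemma perp_eq_0_iff [simp]: "perp d = 0 \<longleftrightarrow> d = 0"
  by (metis norm_eq_zero norm_perp)

lemma inner_perp_self [simp]: "perp d \<bullet> d = 0"
  by (simp add: inner_perp)

text \<open>The orthogonal complement of a nonzero vector in the plane is a line. This pins down the
  normal of a supporting line through two given points up to a scalar.\<close>

lemma orthogonal_imp_parallel_perp:
  assumes "d \<noteq> 0" "w \<bullet> d = 0"
  shows "\<exists>c. w = c *\<^sub>R perp d"
proof -
  have *: "(norm d)\<^sup>2 *\<^sub>R w = (perp d \<bullet> w) *\<^sub>R perp d"
    using assms(2) unfolding vec_eq_iff forall_2 norm_vec2_sq inner_vec2
    by (auto simp: power2_eq_square) (algebra+)
  have "w = ((perp d \<bullet> w) / (norm d)\<^sup>2) *\<^sub>R perp d"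
    using arg_cong[OF *, of "\<lambda>z. (1 / (norm d)\<^sup>2) *\<^sub>R z"] assms(1) by simp
  then show ?thesis by blast
qed

text \<open>An edge condition in finitely many equations and inequalities when \<open>S\<close> is
  finite, from which measurability can be read off. The distance equation places \<open>x\<close>
  between \<open>u\<close> and \<open>v\<close>; it singles out the extreme pair when more than two
  points of \<open>S\<close> lie on the line.\<close>

definition supports_edge :: "(real ^ 2) set \<Rightarrow> real ^ 2 \<Rightarrow> real ^ 2 \<Rightarrow> bool" where
  "supports_edge S u v \<longleftrightarrow> u \<noteq> v \<and>
     ((\<forall>x\<in>S. perp (v - u) \<bullet> (x - u) \<le> 0) \<or> (\<forall>x\<in>S. perp (u - v) \<bullet> (x - v) \<le> 0)) \<and>
     (\<forall>x\<in>S. perp (v - u) \<bullet> (x - u) = 0 \<longrightarrow> dist u v = dist u x + dist x v)"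

lemma inner_perp_reverse: "perp (u - v) \<bullet> (x - v) = - (perp (v - u) \<bullet> (x - u))"
  by (simp add: inner_perp algebra_simps)

text \<open>A compact convex set of dimension 1 is a segment. A face of the hull is itself the hull
  of some points of \<open>S\<close>, so its extreme points \<open>u\<close> and \<open>v\<close>
  belong to \<open>S\<close>.\<close>

lemma edge_of_imp_segment:
  fixes S :: "(real ^ 2) set"
  assumes "finite S" "e edge_of convex hull S"
  obtains u v where "u \<in> S" "v \<in> S" "u \<noteq> v" "e = closed_segment u v"
proof -
  have face: "e face_of convex hull S" and dim: "aff_dim e = 1"
    using assms(2) by (auto simp: edge_of_def)
  have cpt: "compact (convex hull S)" using assms(1) by (simp add: finite_imp_compact compact_convex_hull)
  have "e \<noteq> {}" using dim by auto
  moreover have "compact e" using face_of_imp_compact[OF convex_convex_hull cpt face] .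
  moreover have "convex e" using face face_of_imp_convex by blast
  moreover have "collinear e" using dim by (simp add: collinear_aff_dim)
  ultimately obtain u v where uv: "e = closed_segment u v"
    by (rule compact_convex_collinear_segment)
  have "u \<noteq> v" using dim uv by auto
  obtain S' where S': "S' \<subseteq> S" "e = convex hull S'"
    using face_of_convex_hull_subset[OF finite_imp_compact[OF assms(1)] face] .
  have "u extreme_point_of convex hull S'" "v extreme_point_of convex hull S'"
    using uv S'(2) extreme_point_of_segment by metis+
  then have "u \<in> S" "v \<in> S" using extreme_point_of_convex_hull S'(1) by blast+
  then show ?thesis using that \<open>u \<noteq> v\<close> uv by blast
qed

text \<open>Faces of a polytope are exposed, and in the plane the exposing normal is a multiple of
  \<open>perp (v - u)\<close>. Conversely, the face cut out by the line through \<open>u\<close> and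
  \<open>v\<close> is spanned by points of \<open>S\<close>, all of which lie on the
  segment.\<close>

lemma closed_segment_edge_of_iff:
  fixes S :: "(real ^ 2) set"
  assumes "finite S" "u \<in> S" "v \<in> S"
  shows "closed_segment u v edge_of convex hull S \<longleftrightarrow> supports_edge S u v"
proof
  assume edge: "closed_segment u v edge_of convex hull S"
  then have face: "closed_segment u v face_of convex hull S"
    and dim: "aff_dim (closed_segment u v) = 1" by (auto simp: edge_of_def)
  have "u \<noteq> v" using dim by auto
  have "polyhedron (convex hull S)"
    using assms(1) by (simp add: polyhedron_convex_hull)
  then obtain w b where le: "convex hull S \<subseteq> {x. w \<bullet> x \<le> b}"
    and eq: "closed_segment u v = convex hull S \<inter> {x. w \<bullet> x = b}"
    using face exposed_face_of_polyhedron unfolding exposed_face_of_def by metis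
  have wu: "w \<bullet> u = b" and wv: "w \<bullet> v = b" using eq by auto
  then have "w \<bullet> (v - u) = 0" by (simp add: inner_diff_right)
  then obtain c where c: "w = c *\<^sub>R perp (v - u)"
    using orthogonal_imp_parallel_perp[of "v - u" w] \<open>u \<noteq> v\<close> by auto
  have cle: "c * (perp (v - u) \<bullet> (x - u)) \<le> 0" if "x \<in> S" for x
  proof -
    have "w \<bullet> x \<le> w \<bullet> u" using le wu hull_inc[OF that] by fastforce
    then show ?thesis unfolding c by (simp add: inner_diff_right algebra_simps)
  qed
  have seg: "x \<in> closed_segment u v" if "x \<in> S" "c * (perp (v - u) \<bullet> (x - u)) = 0" for x
  proof -
    have "w \<bullet> x = w \<bullet> u" using that(2) unfolding c by (auto simp: inner_diff_right)
    then show ?thesis using eq wu hull_inc[OF that(1), of convex] by auto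
  qed
  consider "c = 0" | "c > 0" | "c < 0" by linarith
  then have "(\<forall>x\<in>S. perp (v - u) \<bullet> (x - u) \<le> 0) \<or> (\<forall>x\<in>S. perp (u - v) \<bullet> (x - v) \<le> 0)"
  proof cases
    \<comment> \<open>The exposing functional vanishes, so the whole hull is the segment and
      \<open>S\<close> lies on one line.\<close>
    case 1
    have "perp (v - u) \<bullet> (x - u) = 0" if "x \<in> S" for x
    proof -
      have "x \<in> closed_segment u v" using seg that 1 by simp
      then obtain t where "x = (1 - t) *\<^sub>R u + t *\<^sub>R v" by (auto simp: in_segment)
      then have "x - u = t *\<^sub>R (v - u)" by (simp add: algebra_simps)
      then show ?thesis by simp
    qed
    then show ?thesis by simp
  next
    case 2
    then show ?thesis using cle by (auto simp: mult_le_0_iff)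
  next
    case 3
    then show ?thesis using cle by (auto simp: mult_le_0_iff inner_perp_reverse[of u v])
  qed
  moreover have "\<forall>x\<in>S. perp (v - u) \<bullet> (x - u) = 0 \<longrightarrow> dist u v = dist u x + dist x v"
    using seg by (simp flip: between add: between_mem_segment)
  ultimately show "supports_edge S u v" using \<open>u \<noteq> v\<close> by (simp add: supports_edge_def)
next
  assume sup: "supports_edge S u v"
  then have "u \<noteq> v" by (simp add: supports_edge_def)
  have seg: "x \<in> closed_segment u v" if "x \<in> S" "perp (v - u) \<bullet> (x - u) = 0" for x
    using sup that by (simp add: supports_edge_def flip: between between_mem_segment)
  obtain w where le: "\<And>x. x \<in> S \<Longrightarrow> w \<bullet> x \<le> w \<bullet> u" and wv: "w \<bullet> v = w \<bullet> u"
    and seg': "\<And>x. x \<in> S \<Longrightarrow> w \<bullet> x = w \<bullet> u \<Longrightarrow> x \<in> closed_segment u v"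
  proof -
    have *: "perp (v - u) \<bullet> (v - u) = 0" by simp
    consider "\<forall>x\<in>S. perp (v - u) \<bullet> (x - u) \<le> 0" | "\<forall>x\<in>S. - perp (v - u) \<bullet> (x - u) \<le> 0"
      using sup by (auto simp: supports_edge_def inner_perp_reverse[of u v])
    then show ?thesis
    proof cases
      case 1
      then show ?thesis using that[of "perp (v - u)"] seg * by (simp add: inner_diff_right)
    next
      case 2
      then show ?thesis using that[of "- perp (v - u)"] seg * by (simp add: inner_diff_right)
    qed
  qed
  define F where "F = convex hull S \<inter> {x. w \<bullet> x = w \<bullet> u}"
  have "convex hull S \<subseteq> {x. w \<bullet> x \<le> w \<bullet> u}"
    by (rule hull_minimal) (use le in \<open>auto simp: convex_halfspace_le\<close>)
  then have face: "F face_of convex hull S"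
    unfolding F_def by (intro face_of_Int_supporting_hyperplane_le) auto
  obtain S' where S': "S' \<subseteq> S" "F = convex hull S'"
    using face_of_convex_hull_subset[OF finite_imp_compact[OF assms(1)] face] .
  have "S' \<subseteq> F" using S'(2) hull_subset by metis
  then have "S' \<subseteq> closed_segment u v" using seg' S'(1) by (auto simp: F_def)
  then have "F \<subseteq> closed_segment u v" unfolding S'(2) by (simp add: hull_minimal)
  moreover have "{u, v} \<subseteq> F" using assms wv by (auto simp: F_def hull_inc)
  then have "closed_segment u v \<subseteq> F"
    using face_of_imp_convex[OF face] by (simp add: segment_convex_hull hull_minimal)
  ultimately have "F = closed_segment u v" by blast
  moreover have "aff_dim (closed_segment u v) = 1"
    using \<open>u \<noteq> v\<close> by (simp add: segment_convex_hull aff_dim_convex_hull)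
  ultimately show "closed_segment u v edge_of convex hull S" using face by (simp add: edge_of_def)
qed

text \<open>
  Coinciding points are resolved by taking the least indices of the two endpoints, so every edge
  is counted once on degenerate configurations too: integrability needs measurability everywhere,
  not only almost everywhere.
\<close>
definition hull_edge_pairs :: "nat set \<Rightarrow> (nat \<Rightarrow> real ^ 2) \<Rightarrow> (nat \<times> nat) set" where
  "hull_edge_pairs I a = {(i, j) \<in> I \<times> I. i < j \<and> supports_edge (a ` I) (a i) (a j) \<and>
     (\<forall>k\<in>I. k < i \<longrightarrow> a k \<noteq> a i) \<and> (\<forall>k\<in>I. k < j \<longrightarrow> a k \<noteq> a j)}"

lemma supports_edge_commute: "supports_edge S u v \<longleftrightarrow> supports_edge S v u"
  unfolding supports_edge_def inner_perp_reverse[of u v]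
  by (auto simp: dist_commute add.commute)

text \<open>An edge determines its two endpoints, each endpoint has exactly one least index, and
  \<open>i < j\<close> fixes the order of the two.\<close>

lemma num_edges_eq_card_hull_edge_pairs:
  assumes "finite I"
  shows "num_edges (convex hull (a ` I)) = card (hull_edge_pairs I a)"
proof -
  let ?seg = "\<lambda>(i, j). closed_segment (a i) (a j)"
  have fin: "finite (a ` I)" using assms by simp
  have first: "\<exists>i\<in>I. a i = u \<and> (\<forall>k\<in>I. k < i \<longrightarrow> a k \<noteq> a i)" if u: "u \<in> a ` I" for u
  proof -
    define i where "i = (LEAST i. i \<in> I \<and> a i = u)"
    have "\<exists>i. i \<in> I \<and> a i = u" using u by auto
    then have "i \<in> I \<and> a i = u" unfolding i_def by (rule LeastI_ex)
    moreover have "a k \<noteq> u" if "k \<in> I" "k < i" for k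
      using not_less_Least[of k "\<lambda>i. i \<in> I \<and> a i = u"] that unfolding i_def by auto
    ultimately show ?thesis by blast
  qed
  have uniq: "i = i'" if "i \<in> I" "i' \<in> I" "a i = a i'" "\<forall>k\<in>I. k < i \<longrightarrow> a k \<noteq> a i"
    "\<forall>k\<in>I. k < i' \<longrightarrow> a k \<noteq> a i'" for i i'
    using that by (metis linorder_neqE_nat)
  have "bij_betw ?seg (hull_edge_pairs I a) {e. e edge_of convex hull (a ` I)}"
    unfolding bij_betw_def
  proof
    show "inj_on ?seg (hull_edge_pairs I a)"
    proof (rule inj_onI, clarify)
      fix i j i' j'
      assume ij: "(i, j) \<in> hull_edge_pairs I a" and ij': "(i', j') \<in> hull_edge_pairs I a"
        and "closed_segment (a i) (a j) = closed_segment (a i') (a j')"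
      then have "a i = a i' \<and> a j = a j' \<or> a i = a j' \<and> a j = a i'"
        by (auto simp: doubleton_eq_iff)
      then show "i = i' \<and> j = j'"
      proof
        assume "a i = a i' \<and> a j = a j'"
        then show ?thesis using ij ij' uniq[of i i'] uniq[of j j'] by (auto simp: hull_edge_pairs_def)
      next
        assume "a i = a j' \<and> a j = a i'"
        then have "i = j'" "j = i'"
          using ij ij' uniq[of i j'] uniq[of j i'] by (auto simp: hull_edge_pairs_def)
        then show ?thesis using ij ij' by (auto simp: hull_edge_pairs_def)
      qed
    qed
    show "?seg ` hull_edge_pairs I a = {e. e edge_of convex hull (a ` I)}"
    proof safe
      fix i j assume "(i, j) \<in> hull_edge_pairs I a"
      then show "closed_segment (a i) (a j) edge_of convex hull (a ` I)"
        using closed_segment_edge_of_iff[OF fin] by (auto simp: hull_edge_pairs_def)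
    next
      fix e assume e: "e edge_of convex hull (a ` I)"
      obtain u v where uv: "u \<in> a ` I" "v \<in> a ` I" "u \<noteq> v" "e = closed_segment u v"
        using edge_of_imp_segment[OF fin e] .
      have sup: "supports_edge (a ` I) u v"
        using closed_segment_edge_of_iff[OF fin uv(1,2)] e uv(4) by simp
      obtain i j where i: "i \<in> I" "a i = u" "\<forall>k\<in>I. k < i \<longrightarrow> a k \<noteq> a i"
        and j: "j \<in> I" "a j = v" "\<forall>k\<in>I. k < j \<longrightarrow> a k \<noteq> a j"
        using first[OF uv(1)] first[OF uv(2)] by auto
      consider "i < j" | "j < i" using i(2) j(2) uv(3) by (metis linorder_neqE_nat)
      then show "e \<in> ?seg ` hull_edge_pairs I a"
      proof cases
        case 1
        then have "(i, j) \<in> hull_edge_pairs I a"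
          using i j sup by (auto simp: hull_edge_pairs_def)
        then show ?thesis using uv(4) i(2) j(2) by (auto intro!: rev_image_eqI)
      next
        case 2
        then have "(j, i) \<in> hull_edge_pairs I a"
          using i j sup by (auto simp: hull_edge_pairs_def supports_edge_commute)
        then show ?thesis
          using uv(4) i(2) j(2) by (auto intro!: rev_image_eqI simp: closed_segment_commute)
      qed
    qed
  qed
  then show ?thesis by (simp add: num_edges_def bij_betw_same_card)
qed

section \<open>Counting gapped edges\<close>

text \<open>The pair is ordered: for \<open>\<tau> > 0\<close> the unit normal points away from the
  remaining points. At \<open>\<tau> = 0\<close> the condition is weaker than being an edge, as
  further points may lie anywhere on the line.\<close>

definition gap_edge :: "real \<Rightarrow> nat set \<Rightarrow> (nat \<Rightarrow> real ^ 2) \<Rightarrow> nat \<Rightarrow> nat \<Rightarrow> bool" where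
  "gap_edge \<tau> I a i j \<longleftrightarrow> a i \<noteq> a j \<and>
     (\<forall>k \<in> I - {i, j}. sgn (perp (a j - a i)) \<bullet> (a k - a i) \<le> - \<tau>)"

lemma hull_edge_pairs_imp_gap_edge:
  assumes "(i, j) \<in> hull_edge_pairs I a"
  shows "gap_edge 0 I a i j \<or> gap_edge 0 I a j i"
  using assms
  by (auto simp: hull_edge_pairs_def supports_edge_def gap_edge_def sgn_div_norm mult_le_0_iff)

text \<open>Pigeonhole on cells of length \<open>g\<close>: each holds at most one value, and
  \<open>\<lfloor>2 * B / g\<rfloor> + 1\<close> cells cover the range of \<open>f\<close>.\<close>

lemma card_separated_le:
  fixes f :: "'a \<Rightarrow> real"
  assumes "finite A" "g > 0" "B \<ge> 0" "\<And>x. x \<in> A \<Longrightarrow> \<bar>f x\<bar> \<le> B"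
    and "\<And>x y. x \<in> A \<Longrightarrow> y \<in> A \<Longrightarrow> x \<noteq> y \<Longrightarrow> g \<le> \<bar>f x - f y\<bar>"
  shows "real (card A) \<le> 1 + 2 * B / g"
proof -
  let ?h = "\<lambda>x. \<lfloor>(f x + B) / g\<rfloor>"
  have inj: "inj_on ?h A"
  proof (rule inj_onI, rule ccontr)
    fix x y assume xy: "x \<in> A" "y \<in> A" "?h x = ?h y" "x \<noteq> y"
    then have "\<bar>(f x + B) / g - (f y + B) / g\<bar> < 1" by linarith
    also have "(f x + B) / g - (f y + B) / g = (f x - f y) / g"
      by (simp add: diff_divide_distrib[symmetric])
    finally show False using assms(5)[OF xy(1,2,4)] assms(2) by (simp add: abs_divide)
  qed
  have "?h ` A \<subseteq> {0..\<lfloor>2 * B / g\<rfloor>}"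
  proof clarify
    fix x assume "x \<in> A"
    then have "\<bar>f x\<bar> \<le> B" by (rule assms(4))
    then have "0 \<le> (f x + B) / g" "(f x + B) / g \<le> 2 * B / g"
      using assms(2) by (auto intro!: divide_nonneg_pos divide_right_mono)
    then show "?h x \<in> {0..\<lfloor>2 * B / g\<rfloor>}" by (simp add: floor_mono)
  qed
  then have "card A \<le> card {0..\<lfloor>2 * B / g\<rfloor>}"
    using inj by (metis card_image card_mono finite_atLeastAtMost_int)
  also have "\<dots> = nat (\<lfloor>2 * B / g\<rfloor> + 1)" by simp
  finally have "real (card A) \<le> real (nat (\<lfloor>2 * B / g\<rfloor> + 1))" by simp
  also have "\<dots> \<le> 1 + 2 * B / g" using assms(2,3) by simp
  finally show ?thesis .
qed

text \<open>\<open>(c, s)\<close> and \<open>(c', s')\<close> are two unit normals in the first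
  quadrant and \<open>(dx, dy)\<close> is the difference of the starting points. The sign conditions
  force \<open>dx \<ge> 0\<close> and \<open>dy \<le> 0\<close>, so \<open>dx - dy\<close> times
  \<open>(c - c') - (s - s')\<close> is at least the gap \<open>\<tau>\<close>, and AM-GM bounds
  this product by a square.\<close>

lemma separation_in_quadrant_aux:
  fixes c s c' s' dx dy :: real
  assumes "c\<^sup>2 + s\<^sup>2 = 1" "c'\<^sup>2 + s'\<^sup>2 = 1" "0 \<le> c" "0 \<le> s" "0 \<le> c'" "0 \<le> s'"
    and "c * dx + s * dy \<ge> 0" "c' * dx + s' * dy \<le> 0"
    and gap: "(c - c') * dx + (s - s') * dy \<ge> \<tau>" and "\<tau> > 0" "D > 0" "c' \<le> c"
  shows "4 * D * \<tau> \<le> ((dx - dy) + D * ((c - c') - (s - s')))\<^sup>2"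
proof -
  have "s\<^sup>2 \<le> s'\<^sup>2" using assms(1,2,5,12) power_mono[of c' c 2] by linarith
  then have ss: "s \<le> s'" using assms(6) by (rule power2_le_imp_le)
  \<comment> \<open>The second normal lies strictly counterclockwise of the first; equal normals
    would contradict the gap.\<close>
  have "c * s' - c' * s > 0"
  proof (rule ccontr)
    assume "\<not> ?thesis"
    then have le: "c * s' \<le> c' * s" by simp
    have "c' * s \<le> c' * s'" "c' * s' \<le> c * s'" using assms ss by (auto intro: mult_mono)
    then have "c * s' = c' * s'" using le by linarith
    then have "(c - c') * s' = 0" by (simp add: left_diff_distrib)
    moreover have "c \<noteq> c'"
    proof
      assume "c = c'"
      then have "s\<^sup>2 = s'\<^sup>2" using assms(1,2) by simp
      then have "s = s'" using assms(4,6) by simp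
      then show False using \<open>c = c'\<close> gap \<open>\<tau> > 0\<close> by simp
    qed
    ultimately have "s' = 0" by simp
    then have "c\<^sup>2 = c'\<^sup>2" using ss assms(1,2,4) by simp
    then show False using \<open>c \<noteq> c'\<close> assms(3,5) by simp
  qed
  \<comment> \<open>Eliminating \<open>dy\<close>, and then \<open>dx\<close>, from the two sign
    conditions.\<close>
  moreover have "(c * s' - c' * s) * dx \<ge> 0"
    using mult_nonneg_nonneg[OF \<open>0 \<le> s'\<close> assms(7)] mult_nonneg_nonpos[OF \<open>0 \<le> s\<close> assms(8)]
    by (simp add: algebra_simps)
  moreover have "(c * s' - c' * s) * dy \<le> 0"
    using mult_nonneg_nonneg[OF \<open>0 \<le> c'\<close> assms(7)] mult_nonneg_nonpos[OF \<open>0 \<le> c\<close> assms(8)]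
    by (simp add: algebra_simps)
  ultimately have dx: "dx \<ge> 0" and dy: "dy \<le> 0"
    by (auto simp: zero_le_mult_iff mult_le_0_iff)
  let ?u = "dx - dy" and ?v = "(c - c') - (s - s')"
  have "?u * ?v = ((c - c') * dx + (s - s') * dy) + ((s' - s) * dx + (c - c') * (- dy))"
    by (simp add: algebra_simps)
  moreover have "(s' - s) * dx \<ge> 0" "(c - c') * (- dy) \<ge> 0"
    using dx dy ss assms(12) by (auto simp: mult_nonneg_nonpos)
  ultimately have "\<tau> \<le> ?u * ?v" using gap by linarith
  then have "4 * D * \<tau> \<le> 4 * D * (?u * ?v)" using \<open>D > 0\<close> by simp
  also have "\<dots> \<le> (?u + D * ?v)\<^sup>2"
  proof -
    have "(?u + D * ?v)\<^sup>2 - 4 * D * (?u * ?v) = (?u - D * ?v)\<^sup>2"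
      by (simp add: power2_eq_square algebra_simps)
    then show ?thesis by (smt (verit) zero_le_power2)
  qed
  finally show ?thesis .
qed

text \<open>Exchanging the two normals and negating \<open>dx\<close> and \<open>dy\<close>
  preserves the hypotheses and the square, so the order of \<open>c\<close> and \<open>c'\<close>
  can be assumed.\<close>

lemma separation_in_quadrant:
  fixes c s c' s' dx dy :: real
  assumes "c\<^sup>2 + s\<^sup>2 = 1" "c'\<^sup>2 + s'\<^sup>2 = 1" "0 \<le> c" "0 \<le> s" "0 \<le> c'" "0 \<le> s'"
    and "c * dx + s * dy \<ge> 0" "c' * dx + s' * dy \<le> 0"
    and "(c - c') * dx + (s - s') * dy \<ge> \<tau>" and "\<tau> > 0" "D > 0"
  shows "4 * D * \<tau> \<le> ((dx - dy) + D * ((c - c') - (s - s')))\<^sup>2"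
proof (cases "c' \<le> c")
  case True
  then show ?thesis using separation_in_quadrant_aux assms by blast
next
  case False
  have "4 * D * \<tau> \<le> ((- dx - - dy) + D * ((c' - c) - (s' - s)))\<^sup>2"
    by (rule separation_in_quadrant_aux) (use assms False in \<open>auto simp: algebra_simps\<close>)
  also have "(- dx - - dy) + D * ((c' - c) - (s' - s)) = - ((dx - dy) + D * ((c - c') - (s - s')))"
    by (simp add: algebra_simps)
  finally show ?thesis by (simp only: power2_minus)
qed

text \<open>
  The points \<open>p x + D w x\<close> with all normals \<open>w x\<close> in one quadrant form a monotone chain, along
  which the coordinate difference separates them: by AM-GM the product of the changes of
  \<open>p\<close> and of \<open>w\<close>, which is at least \<open>\<tau>\<close>, bounds the change of \<open>p + D w\<close>.
\<close>
lemma card_quadrant_le: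
  fixes w p :: "'a \<Rightarrow> real ^ 2"
  assumes "finite A" "\<tau> > 0" "D > 0" "\<epsilon>\<^sup>2 = 1" "\<delta>\<^sup>2 = 1"
    and "\<And>x. x \<in> A \<Longrightarrow> norm (w x) = 1" "\<And>x. x \<in> A \<Longrightarrow> norm (p x) \<le> D"
    and "\<And>x. x \<in> A \<Longrightarrow> 0 \<le> \<epsilon> * w x $ 1" "\<And>x. x \<in> A \<Longrightarrow> 0 \<le> \<delta> * w x $ 2"
    and "\<And>x y. x \<in> A \<Longrightarrow> y \<in> A \<Longrightarrow> 0 \<le> w x \<bullet> (p x - p y)"
    and "\<And>x y. x \<in> A \<Longrightarrow> y \<in> A \<Longrightarrow> x \<noteq> y \<Longrightarrow> \<tau> \<le> (w x - w y) \<bullet> (p x - p y)"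
  shows "real (card A) \<le> 1 + 4 * sqrt (D / \<tau>)"
proof -
  \<comment> \<open>The signs \<open>\<epsilon>\<close> and \<open>\<delta>\<close> reflect the
    given quadrant onto the first one.\<close>
  define f where "f x = \<epsilon> * (p x $ 1 + D * w x $ 1) - \<delta> * (p x $ 2 + D * w x $ 2)" for x
  have e: "\<bar>\<epsilon>\<bar> = 1" "\<bar>\<delta>\<bar> = 1" using assms(4,5) by (auto simp: power2_eq_1_iff)
  have ee: "\<epsilon> * \<epsilon> = 1" "\<delta> * \<delta> = 1" using assms(4,5) by (auto simp: power2_eq_square)
  \<comment> \<open>Each coordinate of \<open>p x + D *\<^sub>R w x\<close> is at most
    \<open>2 * D\<close> in modulus, which gives the range \<open>4 * D\<close>; the spacing is the
    root of \<open>4 * D * \<tau>\<close>.\<close>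
  have "real (card A) \<le> 1 + 2 * (4 * D) / (2 * sqrt (D * \<tau>))"
  proof (rule card_separated_le)
    fix x assume x: "x \<in> A"
    have q: "\<bar>e * (p x $ i + D * w x $ i)\<bar> \<le> 2 * D" if "\<bar>e\<bar> = 1" for e :: real and i
    proof -
      have "\<bar>p x $ i\<bar> \<le> D" "\<bar>w x $ i\<bar> \<le> 1"
        using component_le_norm_cart[of "p x" i] component_le_norm_cart[of "w x" i]
          assms(6,7)[OF x] by auto
      then have "\<bar>p x $ i\<bar> \<le> D" "\<bar>D * w x $ i\<bar> \<le> D"
        using assms(3) by (auto simp: abs_mult)
      then have "\<bar>p x $ i + D * w x $ i\<bar> \<le> 2 * D" by linarith
      then show ?thesis using that by (simp add: abs_mult)
    qed
    show "\<bar>f x\<bar> \<le> 4 * D" using q[OF e(1), of 1] q[OF e(2), of 2] unfolding f_def by linarith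
  next
    fix x y assume xy: "x \<in> A" "y \<in> A" "x \<noteq> y"
    let ?dx = "\<epsilon> * (p x $ 1 - p y $ 1)" and ?dy = "\<delta> * (p x $ 2 - p y $ 2)"
    have cancel: "(\<epsilon> * z) * (\<epsilon> * z') = z * z'" "(\<delta> * z) * (\<delta> * z') = z * z'" for z z'
      using ee by algebra+
    have sq: "(\<epsilon> * z)\<^sup>2 = z\<^sup>2" "(\<delta> * z)\<^sup>2 = z\<^sup>2" for z
      using assms(4,5) by (auto simp: power_mult_distrib)
    have "4 * D * \<tau> \<le> ((?dx - ?dy) + D * ((\<epsilon> * w x $ 1 - \<epsilon> * w y $ 1) - (\<delta> * w x $ 2 - \<delta> * w y $ 2)))\<^sup>2"
    proof (rule separation_in_quadrant)
      show "(\<epsilon> * w x $ 1)\<^sup>2 + (\<delta> * w x $ 2)\<^sup>2 = 1" "(\<epsilon> * w y $ 1)\<^sup>2 + (\<delta> * w y $ 2)\<^sup>2 = 1"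
        unfolding sq norm_vec2_sq[symmetric] using assms(6) xy by auto
      show "(\<epsilon> * w x $ 1) * ?dx + (\<delta> * w x $ 2) * ?dy \<ge> 0"
        using assms(10)[OF xy(1,2)] unfolding cancel by (simp add: inner_vec2)
      show "(\<epsilon> * w y $ 1) * ?dx + (\<delta> * w y $ 2) * ?dy \<le> 0"
        using assms(10)[OF xy(2,1)] unfolding cancel by (simp add: inner_vec2 algebra_simps)
      have "(\<epsilon> * w x $ 1 - \<epsilon> * w y $ 1) * ?dx + (\<delta> * w x $ 2 - \<delta> * w y $ 2) * ?dy
          = (w x - w y) \<bullet> (p x - p y)"
        unfolding right_diff_distrib[symmetric] cancel by (simp add: inner_vec2)
      then show "(\<epsilon> * w x $ 1 - \<epsilon> * w y $ 1) * ?dx + (\<delta> * w x $ 2 - \<delta> * w y $ 2) * ?dy \<ge> \<tau>"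
        using assms(11)[OF xy] by simp
    qed (use assms xy in auto)
    also have "(?dx - ?dy) + D * ((\<epsilon> * w x $ 1 - \<epsilon> * w y $ 1) - (\<delta> * w x $ 2 - \<delta> * w y $ 2)) = f x - f y"
      by (simp add: f_def algebra_simps)
    finally have "sqrt (4 * (D * \<tau>)) \<le> sqrt ((f x - f y)\<^sup>2)"
      by (intro real_sqrt_le_mono) (simp add: mult.assoc)
    then show "2 * sqrt (D * \<tau>) \<le> \<bar>f x - f y\<bar>" by (simp add: real_sqrt_mult)
  qed (use assms in auto)
  also have "2 * (4 * D) / (2 * sqrt (D * \<tau>)) = 4 * sqrt (D / \<tau>)"
    using assms(2,3) by (simp add: real_sqrt_mult real_sqrt_divide field_simps)
  finally show ?thesis .
qed

text \<open>Each gapped edge is encoded by its unit normal and starting point, which fulfil the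
  hypotheses of \<open>card_quadrant_le\<close>; the four quadrants give the factor 4. A third point
  is what excludes that both orientations of a pair are gapped.\<close>

lemma card_gap_edges_le:
  assumes "finite I" "3 \<le> card I" "\<tau> > 0" "D > 0" "\<And>k. k \<in> I \<Longrightarrow> norm (a k) \<le> D"
  shows "real (card {(i, j) \<in> I \<times> I. gap_edge \<tau> I a i j}) \<le> 4 * (1 + 4 * sqrt (D / \<tau>))"
proof -
  define Q where "Q = {(i, j) \<in> I \<times> I. gap_edge \<tau> I a i j}"
  define w where "w = (\<lambda>(i, j). sgn (perp (a j - a i)))"
  define p where "p = (\<lambda>(i::nat, j::nat). a i)"
  have fin: "finite Q" unfolding Q_def
    by (rule finite_subset[of _ "I \<times> I"]) (use assms(1) in auto)
  have self: "sgn (perp (a j - a i)) \<bullet> (a j - a i) = 0" for i j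
    by (simp add: sgn_div_norm)
  have swap: "sgn (perp (a i - a j)) = - sgn (perp (a j - a i))" for i j
    using perp_minus[of "a j - a i"] by (simp add: sgn_minus)
  have le0: "w e \<bullet> (p e - p f) \<ge> 0" if ef: "e \<in> Q" "f \<in> Q" for e f
  proof -
    obtain i j k l where [simp]: "e = (i, j)" "f = (k, l)" by fastforce
    have "sgn (perp (a j - a i)) \<bullet> (a k - a i) \<le> 0"
      using ef self[of j i] assms(3)
      by (cases "k = i \<or> k = j") (force simp: Q_def gap_edge_def)+
    then show ?thesis by (simp add: w_def p_def inner_diff_right)
  qed
  have gap: "\<tau> \<le> w e \<bullet> (p e - p f)"
    if "e \<in> Q" "f \<in> Q" "fst f \<noteq> fst e" "fst f \<noteq> snd e" for e f
  proof -
    obtain i j k l where [simp]: "e = (i, j)" "f = (k, l)" by fastforce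
    have "sgn (perp (a j - a i)) \<bullet> (a k - a i) \<le> - \<tau>"
      using that by (auto simp: Q_def gap_edge_def)
    then show ?thesis by (simp add: w_def p_def inner_diff_right)
  qed
  have sep: "\<tau> \<le> (w e - w f) \<bullet> (p e - p f)" if ef: "e \<in> Q" "f \<in> Q" "e \<noteq> f" for e f
  proof -
    obtain i j k l where [simp]: "e = (i, j)" "f = (k, l)" by fastforce
    have split: "(w e - w f) \<bullet> (p e - p f) = w e \<bullet> (p e - p f) + w f \<bullet> (p f - p e)"
      by (simp add: inner_diff_left inner_diff_right)
    have ne: "a i \<noteq> a j" "a k \<noteq> a l" using ef by (auto simp: Q_def gap_edge_def)
    \<comment> \<open>With a common start, each edge would have the endpoint of the other strictly
      to its right, but the two determinants are negatives of each other.\<close>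
    have "i \<noteq> k"
    proof
      assume "i = k"
      then have "l \<noteq> j" using ef(3) by auto
      then have "sgn (perp (a j - a i)) \<bullet> (a l - a i) < 0" "sgn (perp (a l - a i)) \<bullet> (a j - a i) < 0"
        using ef ne \<open>i = k\<close> assms(3) by (force simp: Q_def gap_edge_def)+
      then have "perp (a j - a i) \<bullet> (a l - a i) < 0" "perp (a l - a i) \<bullet> (a j - a i) < 0"
        using ne \<open>i = k\<close> by (auto simp: sgn_div_norm divide_less_0_iff inverse_eq_divide)
      then show False by (simp add: inner_perp mult.commute)
    qed
    \<comment> \<open>Unless the edges are reverses of each other, one of them has the starting
      point of the other at distance at least \<open>\<tau>\<close> from its line, and the other
      summand of \<open>split\<close> is nonnegative.\<close>
    consider "k \<noteq> j" | "i \<noteq> l" | "k = j" "l = i" by blast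
    then show ?thesis
    proof cases
      case 1
      then show ?thesis using gap[OF ef(1,2)] le0[OF ef(2,1)] \<open>i \<noteq> k\<close> split by simp
    next
      case 2
      then show ?thesis using gap[OF ef(2,1)] le0[OF ef(1,2)] \<open>i \<noteq> k\<close> split by simp
    next
      case 3
      \<comment> \<open>For reversed edges, a third point would have to lie strictly on both sides
        of the line.\<close>
      have "\<not> I \<subseteq> {i, j}"
      proof
        assume "I \<subseteq> {i, j}"
        then have "card I \<le> card {i, j}" by (intro card_mono) auto
        then show False using assms(2) by (simp add: card_insert_if split: if_splits)
      qed
      then obtain m where m: "m \<in> I - {i, j}" by auto
      then have "sgn (perp (a j - a i)) \<bullet> (a m - a i) \<le> - \<tau>"
        "- sgn (perp (a j - a i)) \<bullet> (a m - a j) \<le> - \<tau>"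
        using ef 3 swap[of i j] by (auto simp: Q_def gap_edge_def)
      then show ?thesis using self[of j i] assms(3) by (simp add: inner_diff_right)
    qed
  qed
  have quad: "real (card {x \<in> Q. 0 \<le> \<epsilon> * w x $ 1 \<and> 0 \<le> \<delta> * w x $ 2}) \<le> 1 + 4 * sqrt (D / \<tau>)"
    if "\<epsilon>\<^sup>2 = 1" "\<delta>\<^sup>2 = 1" for \<epsilon> \<delta> :: real
  proof (rule card_quadrant_le[where w = w and p = p and \<epsilon> = \<epsilon> and \<delta> = \<delta>])
    fix x assume "x \<in> {x \<in> Q. 0 \<le> \<epsilon> * w x $ 1 \<and> 0 \<le> \<delta> * w x $ 2}"
    then show "norm (w x) = 1" "norm (p x) \<le> D"
      using assms(5) by (auto simp: Q_def w_def p_def norm_sgn gap_edge_def)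
  qed (use that assms fin le0 sep in auto)
  let ?q = "\<lambda>\<epsilon> \<delta>. {x \<in> Q. 0 \<le> \<epsilon> * w x $ 1 \<and> 0 \<le> \<delta> * w x $ 2}"
  have "Q \<subseteq> (?q 1 1 \<union> ?q 1 (-1)) \<union> (?q (-1) 1 \<union> ?q (-1) (-1))" by auto
  then have "card Q \<le> card ((?q 1 1 \<union> ?q 1 (-1)) \<union> (?q (-1) 1 \<union> ?q (-1) (-1)))"
    using fin by (intro card_mono) auto
  also have "\<dots> \<le> (card (?q 1 1) + card (?q 1 (-1))) + (card (?q (-1) 1) + card (?q (-1) (-1)))"
    by (meson add_mono card_Un_le order_trans)
  finally have "real (card Q) \<le> (real (card (?q 1 1)) + real (card (?q 1 (-1))))
      + (real (card (?q (-1) 1)) + real (card (?q (-1) (-1))))"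
    by linarith
  then show ?thesis
    using quad[of 1 1] quad[of 1 "-1"] quad[of "-1" 1] quad[of "-1" "-1"] unfolding Q_def by simp
qed

section \<open>Gaussian measures and the shear\<close>

lemma sets_gauss2 [simp, measurable_cong]: "sets (gauss2 \<mu> \<sigma>) = sets borel"
  by (simp add: gauss2_def)

lemma space_gauss2 [simp]: "space (gauss2 \<mu> \<sigma>) = UNIV"
  by (simp add: gauss2_def)

lemma borel_measurable_perp [measurable]: "perp \<in> borel_measurable borel"
proof -
  have "linear perp"
    by (rule linearI) (simp_all add: vec_eq_iff forall_2)
  then show ?thesis
    by (intro borel_measurable_continuous_onI linear_continuous_on linear_conv_bounded_linear[THEN iffD1])
qed

lemma borel_measurable_sgn_perp [measurable]: "(\<lambda>d. sgn (perp d)) \<in> borel_measurable borel"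
  unfolding sgn_div_norm by measurable

section \<open>Translations and shears of Lebesgue measure\<close>

lemma nn_integral_lborel_plus:
  fixes c :: "'a :: euclidean_space"
  assumes [measurable]: "f \<in> borel_measurable borel"
  shows "(\<integral>\<^sup>+x. f (c + x) \<partial>lborel) = (\<integral>\<^sup>+x. f x \<partial>lborel)"
proof -
  have "(\<integral>\<^sup>+x. f x \<partial>lborel) = (\<integral>\<^sup>+x. f x \<partial>distr lborel borel ((+) c))"
    by (simp add: lborel_distr_plus)
  also have "\<dots> = (\<integral>\<^sup>+x. f (c + x) \<partial>lborel)"
    by (subst nn_integral_distr) auto
  finally show ?thesis ..
qed

text \<open>For a fixed difference \<open>d = y - x\<close> the map is a translation by
  \<open>g d\<close>, so Fubini reduces the claim to translation invariance.\<close>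

lemma nn_integral_shear:
  fixes f :: "'a :: euclidean_space \<Rightarrow> 'a \<Rightarrow> ennreal"
  assumes [measurable]: "case_prod f \<in> borel_measurable (borel \<Otimes>\<^sub>M borel)"
    and [measurable]: "g \<in> borel_measurable borel"
  shows "(\<integral>\<^sup>+x. \<integral>\<^sup>+y. f (x + g (y - x)) (y + g (y - x)) \<partial>lborel \<partial>lborel)
    = (\<integral>\<^sup>+x. \<integral>\<^sup>+y. f x y \<partial>lborel \<partial>lborel)"
proof -
  have "(\<integral>\<^sup>+x. \<integral>\<^sup>+y. f (x + g (y - x)) (y + g (y - x)) \<partial>lborel \<partial>lborel)
      = (\<integral>\<^sup>+x. \<integral>\<^sup>+d. f (x + g d) (x + d + g d) \<partial>lborel \<partial>lborel)"
  proof (rule nn_integral_cong)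
    fix x
    show "(\<integral>\<^sup>+y. f (x + g (y - x)) (y + g (y - x)) \<partial>lborel) = (\<integral>\<^sup>+d. f (x + g d) (x + d + g d) \<partial>lborel)"
      using nn_integral_lborel_plus[of "\<lambda>y. f (x + g (y - x)) (y + g (y - x))" x] by simp
  qed
  also have "\<dots> = (\<integral>\<^sup>+d. \<integral>\<^sup>+x. f (x + g d) (x + d + g d) \<partial>lborel \<partial>lborel)"
    by (rule lborel_pair.Fubini') simp
  also have "\<dots> = (\<integral>\<^sup>+d. \<integral>\<^sup>+x. f x (x + d) \<partial>lborel \<partial>lborel)"
  proof (rule nn_integral_cong)
    fix d
    show "(\<integral>\<^sup>+x. f (x + g d) (x + d + g d) \<partial>lborel) = (\<integral>\<^sup>+x. f x (x + d) \<partial>lborel)"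
      using nn_integral_lborel_plus[of "\<lambda>x. f x (x + d)" "g d"] by (simp add: ac_simps)
  qed
  also have "\<dots> = (\<integral>\<^sup>+x. \<integral>\<^sup>+d. f x (x + d) \<partial>lborel \<partial>lborel)"
    by (rule lborel_pair.Fubini') simp
  also have "\<dots> = (\<integral>\<^sup>+x. \<integral>\<^sup>+y. f x y \<partial>lborel \<partial>lborel)"
    by (subst nn_integral_lborel_plus) simp_all
  finally show ?thesis .
qed

section \<open>Bounds for the planar Gaussian density\<close>

definition gauss2_density :: "real ^ 2 \<Rightarrow> real \<Rightarrow> real ^ 2 \<Rightarrow> real" where
  "gauss2_density \<mu> \<sigma> x = exp (- (norm (x - \<mu>))\<^sup>2 / (2 * \<sigma>\<^sup>2)) / (2 * pi * \<sigma>\<^sup>2)"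

lemma gauss2_eq_density: "gauss2 \<mu> \<sigma> = density lborel (\<lambda>x. ennreal (gauss2_density \<mu> \<sigma> x))"
  by (simp add: gauss2_def gauss2_density_def)

lemma gauss2_density_nonneg [simp]: "0 \<le> gauss2_density \<mu> \<sigma> x"
  by (simp add: gauss2_density_def)

lemma borel_measurable_gauss2_density [measurable]: "gauss2_density \<mu> \<sigma> \<in> borel_measurable borel"
  unfolding gauss2_density_def by measurable

text \<open>The shift by at most \<open>\<sigma> / R\<close> raises the squared distance to the mean
  by at most \<open>2 * (R * \<sigma>) * (\<sigma> / R) + \<sigma>\<^sup>2 = 3 *
  \<sigma>\<^sup>2\<close>, hence the exponent drops by at most \<open>3 / 2\<close>.\<close>

lemma gauss2_density_shift_le:
  assumes "\<sigma> > 0" "R \<ge> 1" "norm (x - \<mu>) \<le> R * \<sigma>" "norm w \<le> 1"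
  shows "gauss2_density \<mu> \<sigma> x \<le> exp (3 / 2) * gauss2_density \<mu> \<sigma> (x + (\<sigma> / R) *\<^sub>R w)"
proof -
  let ?\<tau> = "\<sigma> / R"
  have \<tau>: "0 < ?\<tau>" "?\<tau> \<le> \<sigma>" using assms(1,2) by (auto simp: field_simps)
  have "norm (x + ?\<tau> *\<^sub>R w - \<mu>) \<le> norm (x - \<mu>) + norm (?\<tau> *\<^sub>R w)"
    using norm_triangle_ineq[of "x - \<mu>" "?\<tau> *\<^sub>R w"] by (simp add: algebra_simps)
  also have "norm (?\<tau> *\<^sub>R w) \<le> ?\<tau>" using \<tau>(1) assms(1,2,4) mult_left_le[of "norm w" ?\<tau>] by simp
  finally have "(norm (x + ?\<tau> *\<^sub>R w - \<mu>))\<^sup>2 \<le> (norm (x - \<mu>) + ?\<tau>)\<^sup>2"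
    by (intro power_mono) auto
  also have "\<dots> = (norm (x - \<mu>))\<^sup>2 + 2 * norm (x - \<mu>) * ?\<tau> + ?\<tau>\<^sup>2"
    by (rule power2_sum[THEN trans]) simp
  also have "norm (x - \<mu>) * ?\<tau> \<le> (R * \<sigma>) * ?\<tau>" using assms(3) \<tau>(1) by (intro mult_right_mono) auto
  then have "2 * norm (x - \<mu>) * ?\<tau> \<le> 2 * \<sigma>\<^sup>2"
    using assms(2) by (simp add: power2_eq_square)
  also have "?\<tau>\<^sup>2 \<le> \<sigma>\<^sup>2" using \<tau> by (intro power_mono) auto
  finally have "(norm (x + ?\<tau> *\<^sub>R w - \<mu>))\<^sup>2 \<le> (norm (x - \<mu>))\<^sup>2 + 3 * \<sigma>\<^sup>2" by simp
  then have "(norm (x + ?\<tau> *\<^sub>R w - \<mu>))\<^sup>2 / (2 * \<sigma>\<^sup>2) \<le> ((norm (x - \<mu>))\<^sup>2 + 3 * \<sigma>\<^sup>2) / (2 * \<sigma>\<^sup>2)"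
    by (intro divide_right_mono) auto
  also have "\<dots> = (norm (x - \<mu>))\<^sup>2 / (2 * \<sigma>\<^sup>2) + 3 / 2"
    using assms(1) by (simp add: field_simps)
  finally have "exp (- (norm (x - \<mu>))\<^sup>2 / (2 * \<sigma>\<^sup>2))
      \<le> exp (3 / 2 + - (norm (x + ?\<tau> *\<^sub>R w - \<mu>))\<^sup>2 / (2 * \<sigma>\<^sup>2))" by simp
  also have "\<dots> = exp (3 / 2) * exp (- (norm (x + ?\<tau> *\<^sub>R w - \<mu>))\<^sup>2 / (2 * \<sigma>\<^sup>2))"
    by (rule exp_add)
  finally show ?thesis
    unfolding gauss2_density_def times_divide_eq_right by (intro divide_right_mono) auto
qed

text \<open>Outside the disc, half of the exponent is already at least \<open>R\<^sup>2 / 4\<close>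
  in modulus. The other half is the exponent of the Gaussian with deviation
  \<open>sqrt 2 * \<sigma>\<close>, whose normalisation differs by the factor 2.\<close>

lemma gauss2_tail_le:
  assumes "\<sigma> > 0" "R \<ge> 0"
  shows "measure (gauss2 \<mu> \<sigma>) {x. R * \<sigma> < norm (x - \<mu>)} \<le> 2 * exp (- R\<^sup>2 / 4)"
proof -
  interpret prob_space "gauss2 \<mu> \<sigma>" using prob_space_gauss2[OF assms(1)] .
  interpret W: prob_space "gauss2 \<mu> (sqrt 2 * \<sigma>)" using prob_space_gauss2[of "sqrt 2 * \<sigma>"] assms(1) by simp
  let ?A = "{x. R * \<sigma> < norm (x - \<mu>)}"
  have [measurable]: "?A \<in> sets borel" by measurable
  have pt: "gauss2_density \<mu> \<sigma> x * indicator ?A x \<le> 2 * exp (- R\<^sup>2 / 4) * gauss2_density \<mu> (sqrt 2 * \<sigma>) x" for x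
  proof (cases "x \<in> ?A")
    case True
    let ?q = "(norm (x - \<mu>))\<^sup>2"
    have "(R * \<sigma>)\<^sup>2 \<le> ?q" using True assms by (intro power_mono) auto
    then have "R\<^sup>2 \<le> ?q / \<sigma>\<^sup>2" using assms(1) by (simp add: power_mult_distrib field_simps)
    then have "- ?q / (2 * \<sigma>\<^sup>2) \<le> - R\<^sup>2 / 4 + - ?q / (4 * \<sigma>\<^sup>2)" by (simp add: field_simps)
    then have "exp (- ?q / (2 * \<sigma>\<^sup>2)) \<le> exp (- R\<^sup>2 / 4) * exp (- ?q / (4 * \<sigma>\<^sup>2))"
      unfolding exp_add[symmetric] by simp
    then have "exp (- ?q / (2 * \<sigma>\<^sup>2)) / (2 * pi * \<sigma>\<^sup>2)
        \<le> exp (- R\<^sup>2 / 4) * exp (- ?q / (4 * \<sigma>\<^sup>2)) / (2 * pi * \<sigma>\<^sup>2)"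
      by (intro divide_right_mono) auto
    also have "\<dots> = 2 * exp (- R\<^sup>2 / 4) * gauss2_density \<mu> (sqrt 2 * \<sigma>) x"
      by (simp add: gauss2_density_def power_mult_distrib)
    finally show ?thesis using True by (simp add: gauss2_density_def)
  qed simp
  have "emeasure (gauss2 \<mu> \<sigma>) ?A = (\<integral>\<^sup>+x. ennreal (gauss2_density \<mu> \<sigma> x) * indicator ?A x \<partial>lborel)"
    unfolding gauss2_eq_density by (rule emeasure_density) auto
  also have "\<dots> = (\<integral>\<^sup>+x. ennreal (gauss2_density \<mu> \<sigma> x * indicator ?A x) \<partial>lborel)"
    by (simp add: ennreal_mult' ennreal_indicator)
  also have "\<dots> \<le> (\<integral>\<^sup>+x. ennreal (2 * exp (- R\<^sup>2 / 4) * gauss2_density \<mu> (sqrt 2 * \<sigma>) x) \<partial>lborel)"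
    by (intro nn_integral_mono ennreal_leI pt)
  also have "\<dots> = ennreal (2 * exp (- R\<^sup>2 / 4)) * (\<integral>\<^sup>+x. ennreal (gauss2_density \<mu> (sqrt 2 * \<sigma>) x) \<partial>lborel)"
    by (subst nn_integral_cmult[symmetric]) (auto simp: ennreal_mult')
  also have "(\<integral>\<^sup>+x. ennreal (gauss2_density \<mu> (sqrt 2 * \<sigma>) x) \<partial>lborel)
      = emeasure (gauss2 \<mu> (sqrt 2 * \<sigma>)) (space (gauss2 \<mu> (sqrt 2 * \<sigma>)))"
    by (simp add: gauss2_eq_density emeasure_density)
  also have "\<dots> = 1" by (rule W.emeasure_space_1)
  finally show ?thesis by (simp add: emeasure_eq_measure)
qed

text \<open>\<open>K\<close> holds the remaining points, kept fixed. Near the means the densities at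
  \<open>x\<close> and \<open>y\<close> each lose at most a factor \<open>exp (3 / 2)\<close> under
  the shift, and the invariance under the shear then restores the variables.\<close>

lemma nn_integral_shift_pair_le:
  fixes K :: "(real ^ 2) set"
  assumes "\<sigma> > 0" "R \<ge> 1" "finite K"
  defines "G \<equiv> \<lambda>\<tau> x y. x \<noteq> y \<and> (\<forall>z\<in>K. sgn (perp (y - x)) \<bullet> (z - x) \<le> - \<tau>)"
  shows "(\<integral>\<^sup>+x. \<integral>\<^sup>+y. (if G 0 x y \<and> norm (x - \<mu>) \<le> R * \<sigma> \<and> norm (y - \<nu>) \<le> R * \<sigma> then 1 else 0)
      \<partial>gauss2 \<nu> \<sigma> \<partial>gauss2 \<mu> \<sigma>)
    \<le> ennreal (exp 3) * (\<integral>\<^sup>+x. \<integral>\<^sup>+y. (if G (\<sigma> / R) x y then 1 else 0) \<partial>gauss2 \<nu> \<sigma> \<partial>gauss2 \<mu> \<sigma>)"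
    (is "?L \<le> _ * ?R")
proof -
  let ?\<tau> = "\<sigma> / R"
  let ?g = "gauss2_density \<mu> \<sigma>" and ?h = "gauss2_density \<nu> \<sigma>"
  let ?s = "\<lambda>d. ?\<tau> *\<^sub>R sgn (perp d)"
  have G_alt: "G \<tau> x y \<longleftrightarrow> 0 < norm (x - y) \<and> (\<forall>z\<in>K. sgn (perp (y - x)) \<bullet> (z - x) \<le> - \<tau>)" for \<tau> x y
    by (simp add: G_def)
  have [measurable]: "Measurable.pred (borel \<Otimes>\<^sub>M borel) (\<lambda>p. G \<tau> (fst p) (snd p))" for \<tau>
    unfolding G_alt using assms(3) by measurable
  have [measurable]: "Measurable.pred borel (\<lambda>y. G \<tau> x y)" for \<tau> x
    unfolding G_alt using assms(3) by measurable
  let ?f = "\<lambda>x y. ennreal (?g x) * (ennreal (?h y) * (if G ?\<tau> x y then 1 else 0))"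
  let ?b = "\<lambda>x y. G 0 x y \<and> norm (x - \<mu>) \<le> R * \<sigma> \<and> norm (y - \<nu>) \<le> R * \<sigma>"
  have unfold: "(\<integral>\<^sup>+x. \<integral>\<^sup>+y. (if B x y then 1 else 0) \<partial>gauss2 \<nu> \<sigma> \<partial>gauss2 \<mu> \<sigma>)
      = (\<integral>\<^sup>+x. \<integral>\<^sup>+y. ennreal (?g x) * (ennreal (?h y) * (if B x y then 1 else 0)) \<partial>lborel \<partial>lborel)"
    if [measurable]: "Measurable.pred (borel \<Otimes>\<^sub>M borel) (\<lambda>p. B (fst p) (snd p))" for B
  proof -
    have [measurable]: "Measurable.pred borel (\<lambda>y. B x y)" for x
    proof -
      have "Pair x \<in> borel \<rightarrow>\<^sub>M borel \<Otimes>\<^sub>M borel" by simp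
      from measurable_compose[OF this that] show ?thesis by simp
    qed
    have "(\<integral>\<^sup>+x. \<integral>\<^sup>+y. (if B x y then 1 else 0) \<partial>gauss2 \<nu> \<sigma> \<partial>gauss2 \<mu> \<sigma>)
      = (\<integral>\<^sup>+x. \<integral>\<^sup>+y. ennreal (?h y) * (if B x y then 1 else 0) \<partial>lborel \<partial>gauss2 \<mu> \<sigma>)"
      unfolding gauss2_eq_density by (subst nn_integral_density) auto
    also have "\<dots> = (\<integral>\<^sup>+x. ennreal (?g x) * (\<integral>\<^sup>+y. ennreal (?h y) * (if B x y then 1 else 0) \<partial>lborel) \<partial>lborel)"
      unfolding gauss2_eq_density by (subst nn_integral_density) auto
    also have "\<dots> = (\<integral>\<^sup>+x. \<integral>\<^sup>+y. ennreal (?g x) * (ennreal (?h y) * (if B x y then 1 else 0)) \<partial>lborel \<partial>lborel)"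
      by (subst nn_integral_cmult) auto
    finally show ?thesis .
  qed
  \<comment> \<open>The shift leaves \<open>y - x\<close>, and so the normal, unchanged and lowers
    every signed distance by exactly \<open>\<sigma> / R\<close>.\<close>
  have shift: "G ?\<tau> (x + ?s (y - x)) (y + ?s (y - x)) \<longleftrightarrow> G 0 x y" for x y
  proof (cases "x = y")
    case False
    have "sgn (perp (y - x)) \<bullet> sgn (perp (y - x)) = 1"
      using False by (simp add: norm_eq_1[symmetric] norm_sgn)
    then show ?thesis by (simp add: G_def algebra_simps)
  qed (simp add: G_def)
  have pt: "ennreal (?g x) * (ennreal (?h y) * (if ?b x y then 1 else 0))
      \<le> ennreal (exp 3) * ?f (x + ?s (y - x)) (y + ?s (y - x))" for x y
  proof (cases "?b x y")
    case True
    have w: "norm (sgn (perp (y - x))) \<le> 1" by (simp add: norm_sgn)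
    have "?g x * ?h y \<le> (exp (3 / 2) * ?g (x + ?s (y - x))) * (exp (3 / 2) * ?h (y + ?s (y - x)))"
      using True w assms(1,2) by (intro mult_mono gauss2_density_shift_le) auto
    also have "\<dots> = (exp (3 / 2) * exp (3 / 2)) * (?g (x + ?s (y - x)) * ?h (y + ?s (y - x)))"
      by (simp add: ac_simps)
    also have "exp (3 / 2) * exp (3 / 2) = (exp 3 :: real)" by (simp add: exp_add[symmetric])
    finally have "ennreal (?g x * ?h y) \<le> ennreal (exp 3 * (?g (x + ?s (y - x)) * ?h (y + ?s (y - x))))"
      by (rule ennreal_leI)
    then show ?thesis unfolding shift using True by (simp add: ennreal_mult')
  next
    case False
    then show ?thesis unfolding if_not_P[OF False] by simp
  qed
  have "?L = (\<integral>\<^sup>+x. \<integral>\<^sup>+y. ennreal (?g x) * (ennreal (?h y) * (if ?b x y then 1 else 0)) \<partial>lborel \<partial>lborel)"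
    by (rule unfold) measurable
  also have "\<dots> \<le> (\<integral>\<^sup>+x. \<integral>\<^sup>+y. ennreal (exp 3) * ?f (x + ?s (y - x)) (y + ?s (y - x)) \<partial>lborel \<partial>lborel)"
    by (intro nn_integral_mono pt)
  also have "\<dots> = ennreal (exp 3) * (\<integral>\<^sup>+x. \<integral>\<^sup>+y. ?f (x + ?s (y - x)) (y + ?s (y - x)) \<partial>lborel \<partial>lborel)"
    unfolding shift by (simp add: nn_integral_cmult)
  also have "(\<integral>\<^sup>+x. \<integral>\<^sup>+y. ?f (x + ?s (y - x)) (y + ?s (y - x)) \<partial>lborel \<partial>lborel)
      = (\<integral>\<^sup>+x. \<integral>\<^sup>+y. ?f x y \<partial>lborel \<partial>lborel)"
    by (rule nn_integral_shear) (simp_all add: case_prod_beta')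
  also have "\<dots> = ?R" by (rule unfold[symmetric]) measurable
  finally show ?thesis .
qed

section \<open>The expected number of edges\<close>

locale gaussian_points =
  fixes I :: "nat set" and abar :: "nat \<Rightarrow> real ^ 2" and \<sigma> :: real
  assumes finite_I [simp]: "finite I" and sigma_pos: "\<sigma> > 0"
begin

abbreviation P :: "(nat \<Rightarrow> real ^ 2) measure" where
  "P \<equiv> \<Pi>\<^sub>M k\<in>I. gauss2 (abar k) \<sigma>"

sublocale product_prob_space "\<lambda>k. gauss2 (abar k) \<sigma>" I
  by (rule product_prob_spaceI) (rule prob_space_gauss2[OF sigma_pos])

section \<open>Measurability of the edge events\<close>

lemma measurable_component [measurable]: "k \<in> I \<Longrightarrow> (\<lambda>a. a k) \<in> borel_measurable P"
  using measurable_component_singleton[of k I "\<lambda>k. gauss2 (abar k) \<sigma>"]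
  by (simp add: measurable_cong_sets[OF refl sets_gauss2])

lemma pred_points_eq [measurable]:
  assumes [measurable]: "i \<in> I" "j \<in> I"
  shows "Measurable.pred P (\<lambda>a. a i = a j)"
proof -
  have "Measurable.pred P (\<lambda>a. norm (a i - a j) = 0)" by measurable
  then show ?thesis by simp
qed

lemma pred_gap_edge [measurable]:
  assumes [measurable]: "i \<in> I" "j \<in> I"
  shows "Measurable.pred P (\<lambda>a. gap_edge \<tau> I a i j)"
proof -
  have [measurable]: "(\<lambda>a. sgn (perp (a j - a i))) \<in> borel_measurable P"
    by (rule measurable_compose[OF _ borel_measurable_sgn_perp]) measurable
  have "Measurable.pred P (\<lambda>a. \<forall>k \<in> I - {i, j}. sgn (perp (a j - a i)) \<bullet> (a k - a i) \<le> - \<tau>)"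
    by (rule pred_intros_finite) auto
  then show ?thesis unfolding gap_edge_def by measurable
qed

text \<open>A finite Boolean combination of equations and inequalities between measurable
  functions.\<close>

lemma pred_hull_edge_pairs [measurable]:
  "Measurable.pred P (\<lambda>a. p \<in> hull_edge_pairs I a)"
proof (cases "p \<in> I \<times> I")
  case True
  obtain i j where p: "p = (i, j)" by fastforce
  then have [measurable]: "i \<in> I" "j \<in> I" using True by auto
  have [measurable]: "(\<lambda>a. perp (a j - a i)) \<in> borel_measurable P"
    "(\<lambda>a. perp (a i - a j)) \<in> borel_measurable P"
    by (rule measurable_compose[OF _ borel_measurable_perp]; measurable)+
  have le: "Measurable.pred P (\<lambda>a. perp (a j - a i) \<bullet> (a k - a i) \<le> 0)" if [measurable]: "k \<in> I" for k
    by measurable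
  have le': "Measurable.pred P (\<lambda>a. perp (a i - a j) \<bullet> (a k - a j) \<le> 0)" if [measurable]: "k \<in> I" for k
    by measurable
  have eq: "Measurable.pred P (\<lambda>a. perp (a j - a i) \<bullet> (a k - a i) = 0)" if [measurable]: "k \<in> I" for k
    by measurable
  have seg: "Measurable.pred P (\<lambda>a. dist (a i) (a j) = dist (a i) (a k) + dist (a k) (a j))"
    if [measurable]: "k \<in> I" for k
  proof -
    have [measurable]: "(\<lambda>a. dist (a k) (a l)) \<in> borel_measurable P" if "k \<in> I" "l \<in> I" for k l
      by (intro borel_measurable_dist measurable_component that)
    have "Measurable.pred P (\<lambda>a. dist (a i) (a j) - (dist (a i) (a k) + dist (a k) (a j)) = 0)"
      by measurable
    then show ?thesis by simp
  qed
  have seg': "Measurable.pred P (\<lambda>a. \<forall>k\<in>I. perp (a j - a i) \<bullet> (a k - a i) = 0 \<longrightarrow>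
      dist (a i) (a j) = dist (a i) (a k) + dist (a k) (a j))"
    by (intro pred_intros_finite(3) finite_I pred_intros_logic(4) eq seg)
  have all_le: "Measurable.pred P (\<lambda>a. \<forall>k\<in>I. perp (a j - a i) \<bullet> (a k - a i) \<le> 0)"
    and all_le': "Measurable.pred P (\<lambda>a. \<forall>k\<in>I. perp (a i - a j) \<bullet> (a k - a j) \<le> 0)"
    by (intro pred_intros_finite(3) finite_I le le'; assumption)+
  have first: "Measurable.pred P (\<lambda>a. \<forall>k\<in>I. k < l \<longrightarrow> a k \<noteq> a l)" if "l \<in> I" for l
    by (intro pred_intros_finite(3) finite_I pred_intros_logic(2,4) measurable_const pred_points_eq that) simp
  have eqv: "p \<in> hull_edge_pairs I a \<longleftrightarrow> i < j \<and> \<not> a i = a j \<and>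
      ((\<forall>k\<in>I. perp (a j - a i) \<bullet> (a k - a i) \<le> 0) \<or> (\<forall>k\<in>I. perp (a i - a j) \<bullet> (a k - a j) \<le> 0)) \<and>
      (\<forall>k\<in>I. perp (a j - a i) \<bullet> (a k - a i) = 0 \<longrightarrow> dist (a i) (a j) = dist (a i) (a k) + dist (a k) (a j)) \<and>
      (\<forall>k\<in>I. k < i \<longrightarrow> a k \<noteq> a i) \<and> (\<forall>k\<in>I. k < j \<longrightarrow> a k \<noteq> a j)" for a
    using True unfolding p hull_edge_pairs_def supports_edge_def by blast
  show ?thesis
    unfolding eqv
    by (intro pred_intros_logic(2,3,5) measurable_const pred_points_eq all_le all_le' seg' first
        \<open>i \<in> I\<close> \<open>j \<in> I\<close>) simp
next
  case False
  then have "p \<notin> hull_edge_pairs I a" for a by (auto simp: hull_edge_pairs_def)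
  then show ?thesis by simp
qed

section \<open>Probabilities for single points and pairs\<close>

lemma prob_far_le:
  assumes "k \<in> I" "R \<ge> 0"
  shows "prob {a \<in> space P. R * \<sigma> < norm (a k - abar k)} \<le> 2 * exp (- R\<^sup>2 / 4)"
proof -
  have "{x. R * \<sigma> < norm (x - abar k)} \<in> sets (gauss2 (abar k) \<sigma>)" by measurable
  from emeasure_PiM_Collect_single[OF assms(1) this]
  have "prob {a \<in> space P. R * \<sigma> < norm (a k - abar k)}
      = measure (gauss2 (abar k) \<sigma>) {x. R * \<sigma> < norm (x - abar k)}"
    by (simp add: measure_def)
  then show ?thesis using gauss2_tail_le[OF sigma_pos assms(2)] by simp
qed

text \<open>Fubini with \<open>a i\<close> and \<open>a j\<close> as innermost variables: the other
  points are frozen, and \<open>nn_integral_shift_pair_le\<close> applies to the inner double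
  integral.\<close>

lemma prob_gap_edge_shift:
  assumes ij: "i \<in> I" "j \<in> I" "i \<noteq> j" and "R \<ge> 1"
  shows "prob {a \<in> space P. gap_edge 0 I a i j \<and> norm (a i - abar i) \<le> R * \<sigma> \<and> norm (a j - abar j) \<le> R * \<sigma>}
    \<le> exp 3 * prob {a \<in> space P. gap_edge (\<sigma> / R) I a i j}"
proof -
  define J where "J = I - {i, j}"
  have I: "I = insert j (insert i J)" and J: "finite J" "i \<notin> J" "j \<notin> insert i J"
    using ij by (auto simp: J_def)
  note [measurable] = ij(1,2)
  let ?M = "\<lambda>k. gauss2 (abar k) \<sigma>"
  have upd: "(\<lambda>z. (fst z)(k := snd z)) \<in> Pi\<^sub>M K ?M \<Otimes>\<^sub>M ?M k \<rightarrow>\<^sub>M Pi\<^sub>M (insert k K) ?M" for k K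
    by measurable
  \<comment> \<open>Integrating out one coordinate preserves measurability; applied first to
    \<open>j\<close>, then to \<open>i\<close>.\<close>
  have meas: "(\<lambda>r. \<integral>\<^sup>+y. f (r(k := y)) \<partial>?M k) \<in> borel_measurable (Pi\<^sub>M K ?M)"
    if "f \<in> borel_measurable (Pi\<^sub>M (insert k K) ?M)" for f :: "_ \<Rightarrow> ennreal" and k K
    using measurable_compose[OF upd that]
    by (intro sigma_finite_measure.borel_measurable_nn_integral[OF sigma_finite_measures])
      (simp add: case_prod_beta')
  have meas2: "(\<lambda>r. \<integral>\<^sup>+x. \<integral>\<^sup>+y. (if Q (r(i := x, j := y)) then 1 else 0) \<partial>?M j \<partial>?M i)
      \<in> borel_measurable (Pi\<^sub>M J ?M)" if [measurable]: "Measurable.pred P Q" for Q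
  proof -
    have "(\<lambda>a. if Q a then 1 else 0 :: ennreal) \<in> borel_measurable P" by measurable
    then show ?thesis unfolding I by (rule meas[OF meas])
  qed
  have em: "emeasure P {a \<in> space P. Q a} = (\<integral>\<^sup>+r. \<integral>\<^sup>+x. \<integral>\<^sup>+y. (if Q (r(i := x, j := y)) then 1 else 0)
      \<partial>?M j \<partial>?M i \<partial>Pi\<^sub>M J ?M)"
    if [measurable]: "Measurable.pred P Q" for Q
  proof -
    have f: "(\<lambda>a. if Q a then 1 else 0 :: ennreal) \<in> borel_measurable (Pi\<^sub>M (insert j (insert i J)) ?M)"
      unfolding I[symmetric] by measurable
    have "emeasure P {a \<in> space P. Q a} = (\<integral>\<^sup>+a. indicator {a \<in> space P. Q a} a \<partial>P)"
      by (rule nn_integral_indicator[symmetric]) measurable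
    also have "\<dots> = (\<integral>\<^sup>+a. (if Q a then 1 else 0) \<partial>P)"
      by (intro nn_integral_cong) (simp add: indicator_def)
    also have "\<dots> = (\<integral>\<^sup>+r. \<integral>\<^sup>+y. (if Q (r(j := y)) then 1 else 0) \<partial>?M j \<partial>Pi\<^sub>M (insert i J) ?M)"
      unfolding I by (rule product_nn_integral_insert[OF _ J(3) f]) (use J in auto)
    also have "\<dots> = (\<integral>\<^sup>+r. \<integral>\<^sup>+x. \<integral>\<^sup>+y. (if Q (r(i := x, j := y)) then 1 else 0)
      \<partial>?M j \<partial>?M i \<partial>Pi\<^sub>M J ?M)"
      by (rule product_nn_integral_insert[OF J(1,2) meas[OF f]])
    finally show ?thesis .
  qed
  have gap: "gap_edge \<tau> I (r(i := x, j := y)) i j \<longleftrightarrow>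
      x \<noteq> y \<and> (\<forall>z \<in> r ` J. sgn (perp (y - x)) \<bullet> (z - x) \<le> - \<tau>)" for \<tau> r x y
    using ij(3) by (auto simp: gap_edge_def J_def)
  have "emeasure P {a \<in> space P. gap_edge 0 I a i j \<and> norm (a i - abar i) \<le> R * \<sigma> \<and> norm (a j - abar j) \<le> R * \<sigma>}
    \<le> (\<integral>\<^sup>+r. ennreal (exp 3) * (\<integral>\<^sup>+x. \<integral>\<^sup>+y. (if gap_edge (\<sigma> / R) I (r(i := x, j := y)) i j then 1 else 0)
      \<partial>?M j \<partial>?M i) \<partial>Pi\<^sub>M J ?M)"
  proof (subst em)
    show "Measurable.pred P (\<lambda>a. gap_edge 0 I a i j \<and> norm (a i - abar i) \<le> R * \<sigma> \<and> norm (a j - abar j) \<le> R * \<sigma>)"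
      by measurable
  qed (unfold gap, intro nn_integral_mono,
      use nn_integral_shift_pair_le[OF sigma_pos \<open>R \<ge> 1\<close>, of "_ ` J" "abar i" "abar j"] J(1) ij(3) in simp)
  also have "\<dots> = ennreal (exp 3) * emeasure P {a \<in> space P. gap_edge (\<sigma> / R) I a i j}"
    by (subst em[OF pred_gap_edge[OF ij(1,2)]], intro nn_integral_cmult meas2) measurable
  finally show ?thesis
    by (simp add: emeasure_eq_measure ennreal_mult'[symmetric])
qed

section \<open>Expected counts\<close>

lemma expectation_card_eq_sum_prob:
  assumes "finite A" "\<And>p. p \<in> A \<Longrightarrow> Measurable.pred P (Q p)"
  shows "integrable P (\<lambda>a. real (card {p \<in> A. Q p a}))"
    and "expectation (\<lambda>a. real (card {p \<in> A. Q p a})) = (\<Sum>p\<in>A. prob {a \<in> space P. Q p a})"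
proof -
  have eq: "real (card {p \<in> A. Q p a}) = (\<Sum>p\<in>A. indicator {a \<in> space P. Q p a} a)" if "a \<in> space P" for a
  proof -
    have "real (card {p \<in> A. Q p a}) = (\<Sum>p\<in>{p \<in> A. Q p a}. 1)" by simp
    also have "\<dots> = (\<Sum>p\<in>A. if Q p a then 1 else 0)"
      using assms(1) by (rule sum.inter_filter)
    finally show ?thesis using that by (auto simp: indicator_def intro!: sum.cong)
  qed
  have sets: "{a \<in> space P. Q p a} \<in> events" if "p \<in> A" for p
    using assms(2)[OF that] by measurable
  have int: "integrable P (indicator {a \<in> space P. Q p a} :: _ \<Rightarrow> real)" if "p \<in> A" for p
    using sets[OF that] by (simp add: emeasure_eq_measure)
  have "integrable P (\<lambda>a. \<Sum>p\<in>A. indicator {a \<in> space P. Q p a} a :: real)"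
    using int by (rule Bochner_Integration.integrable_sum)
  then show "integrable P (\<lambda>a. real (card {p \<in> A. Q p a}))"
    by (subst Bochner_Integration.integrable_cong[OF refl eq]) auto
  have "expectation (\<lambda>a. real (card {p \<in> A. Q p a}))
      = expectation (\<lambda>a. \<Sum>p\<in>A. indicator {a \<in> space P. Q p a} a)"
    by (intro Bochner_Integration.integral_cong refl eq)
  also have "\<dots> = (\<Sum>p\<in>A. expectation (indicator {a \<in> space P. Q p a}))"
    using int by (rule Bochner_Integration.integral_sum)
  also have "\<dots> = (\<Sum>p\<in>A. prob {a \<in> space P. Q p a})"
    using sets by (intro sum.cong refl) simp
  finally show "expectation (\<lambda>a. real (card {p \<in> A. Q p a})) = (\<Sum>p\<in>A. prob {a \<in> space P. Q p a})" .
qed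

lemma integrable_num_edges: "integrable P (\<lambda>a. real (num_edges (convex hull (a ` I))))"
proof -
  have "num_edges (convex hull (a ` I)) = card {p \<in> I \<times> I. p \<in> hull_edge_pairs I a}" for a
    unfolding num_edges_eq_card_hull_edge_pairs[OF finite_I]
    by (rule arg_cong[where f = card]) (auto simp: hull_edge_pairs_def)
  then show ?thesis
    using expectation_card_eq_sum_prob(1)[of "I \<times> I" "\<lambda>p a. p \<in> hull_edge_pairs I a"] by simp
qed

abbreviation gap_edges :: "real \<Rightarrow> (nat \<Rightarrow> real ^ 2) \<Rightarrow> (nat \<times> nat) set" where
  "gap_edges \<tau> a \<equiv> {p \<in> I \<times> I. gap_edge \<tau> I a (fst p) (snd p)}"

text \<open>A pair in \<open>hull_edge_pairs\<close> has \<open>i < j\<close>, whereas the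
  orientation with all points on the correct side may be \<open>(j, i)\<close>; adding the swapped
  pairs costs the factor 2.\<close>

lemma num_edges_le_gap_edges: "num_edges (convex hull (a ` I)) \<le> 2 * card (gap_edges 0 a)"
proof -
  have fin: "finite (gap_edges 0 a)" by simp
  have "hull_edge_pairs I a \<subseteq> gap_edges 0 a \<union> prod.swap ` gap_edges 0 a"
  proof
    fix p assume p: "p \<in> hull_edge_pairs I a"
    obtain i j where [simp]: "p = (i, j)" by fastforce
    have "i \<in> I" "j \<in> I" using p by (auto simp: hull_edge_pairs_def)
    then show "p \<in> gap_edges 0 a \<union> prod.swap ` gap_edges 0 a"
      using hull_edge_pairs_imp_gap_edge[of i j I a] p by (auto intro!: rev_image_eqI[of "(j, i)"])
  qed
  then have "card (hull_edge_pairs I a) \<le> card (gap_edges 0 a \<union> prod.swap ` gap_edges 0 a)"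
    using fin by (intro card_mono) auto
  also have "\<dots> \<le> card (gap_edges 0 a) + card (prod.swap ` gap_edges 0 a)" by (rule card_Un_le)
  also have "\<dots> \<le> 2 * card (gap_edges 0 a)" using card_image_le[OF fin, of prod.swap] by simp
  finally show ?thesis by (simp add: num_edges_eq_card_hull_edge_pairs)
qed

text \<open>Either both endpoints are near their means and the shift applies, or one is far, which
  costs two tails of \<open>2 * exp (- R\<^sup>2 / 4)\<close> each.\<close>

lemma prob_gap_edge_zero_le:
  assumes ij: "i \<in> I" "j \<in> I" and "R \<ge> 1"
  shows "prob {a \<in> space P. gap_edge 0 I a i j}
    \<le> exp 3 * prob {a \<in> space P. gap_edge (\<sigma> / R) I a i j} + 4 * exp (- R\<^sup>2 / 4)"
proof (cases "i = j")
  case True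
  then have "{a \<in> space P. gap_edge 0 I a i j} = {}" by (auto simp: gap_edge_def)
  then show ?thesis by (metis (no_types, lifting) add_nonneg_nonneg exp_ge_zero measure_empty
        measure_nonneg mult_nonneg_nonneg zero_le_numeral)
next
  case False
  note [measurable] = ij
  let ?near = "{a \<in> space P. gap_edge 0 I a i j \<and> norm (a i - abar i) \<le> R * \<sigma> \<and> norm (a j - abar j) \<le> R * \<sigma>}"
  let ?far = "\<lambda>k. {a \<in> space P. R * \<sigma> < norm (a k - abar k)}"
  have [measurable]: "?near \<in> events" "?far i \<in> events" "?far j \<in> events" by measurable
  have "prob {a \<in> space P. gap_edge 0 I a i j} \<le> prob (?near \<union> (?far i \<union> ?far j))"
    by (intro finite_measure_mono) auto
  also have "\<dots> \<le> prob ?near + (prob (?far i) + prob (?far j))"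
    by (intro order_trans[OF measure_Un_le] add_left_mono measure_Un_le) auto
  also have "\<dots> \<le> exp 3 * prob {a \<in> space P. gap_edge (\<sigma> / R) I a i j}
      + (2 * exp (- R\<^sup>2 / 4) + 2 * exp (- R\<^sup>2 / 4))"
    using prob_gap_edge_shift[OF ij False \<open>R \<ge> 1\<close>] prob_far_le[OF ij(1), of R] prob_far_le[OF ij(2), of R]
      \<open>R \<ge> 1\<close> by (intro add_mono) auto
  finally show ?thesis by simp
qed

text \<open>If all points are within \<open>R * \<sigma>\<close> of their means, they have norm at
  most \<open>1 + R * \<sigma>\<close> and the deterministic count applies. Otherwise the number of
  all ordered pairs is the bound, and summing the tails over the points adds the third factor
  \<open>card I\<close>.\<close>

lemma expectation_gap_edges_le:
  assumes "3 \<le> card I" "\<And>k. k \<in> I \<Longrightarrow> norm (abar k) \<le> 1" "R \<ge> 0" "\<tau> > 0"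
  shows "expectation (\<lambda>a. real (card (gap_edges \<tau> a)))
    \<le> 4 * (1 + 4 * sqrt ((1 + R * \<sigma>) / \<tau>)) + real (card I) ^ 3 * (2 * exp (- R\<^sup>2 / 4))"
proof -
  let ?B = "4 * (1 + 4 * sqrt ((1 + R * \<sigma>) / \<tau>))"
  let ?far = "\<lambda>a. {k \<in> I. R * \<sigma> < norm (a k - abar k)}"
  have D: "1 + R * \<sigma> > 0" using assms(3) sigma_pos by (simp add: add_pos_nonneg)
  have B: "?B \<ge> 0" using D assms(4) by simp
  \<comment> \<open>The number of far points replaces the indicator that one exists, so that the
    expectation becomes a sum of tails.\<close>
  have pt: "real (card (gap_edges \<tau> a)) \<le> ?B + real (card I) ^ 2 * real (card (?far a))" for a
  proof (cases "?far a = {}")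
    case True
    have "norm (a k) \<le> 1 + R * \<sigma>" if "k \<in> I" for k
    proof -
      have "norm (a k) \<le> norm (abar k) + norm (a k - abar k)" by (rule norm_triangle_sub)
      then show ?thesis using assms(2)[OF that] True that by force
    qed
    from card_gap_edges_le[OF finite_I assms(1,4) D this]
    have "?B \<ge> real (card {(i, j) \<in> I \<times> I. gap_edge \<tau> I a i j})" .
    also have "{(i, j) \<in> I \<times> I. gap_edge \<tau> I a i j} = gap_edges \<tau> a" by auto
    finally show ?thesis unfolding True by simp
  next
    case False
    then have "1 \<le> card (?far a)" by (simp add: card_gt_0_iff Suc_le_eq)
    then have "real (card I) ^ 2 * 1 \<le> real (card I) ^ 2 * real (card (?far a))"
      by (intro mult_left_mono) auto
    moreover have "card (gap_edges \<tau> a) \<le> card (I \<times> I)" by (intro card_mono) auto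
    then have "real (card (gap_edges \<tau> a)) \<le> real (card I) ^ 2"
      by (metis card_cartesian_product of_nat_le_iff of_nat_mult power2_eq_square)
    ultimately show ?thesis using B by linarith
  qed
  have gap: "integrable P (\<lambda>a. real (card (gap_edges \<tau> a)))"
    by (rule expectation_card_eq_sum_prob) auto
  have meas: "Measurable.pred P (\<lambda>a. R * \<sigma> < norm (a k - abar k))" if [measurable]: "k \<in> I" for k
    by measurable
  note far = expectation_card_eq_sum_prob[OF finite_I,
      of "\<lambda>k a. R * \<sigma> < norm (a k - abar k)", OF meas]
  have "expectation (\<lambda>a. real (card (gap_edges \<tau> a)))
      \<le> expectation (\<lambda>a. ?B + real (card I) ^ 2 * real (card (?far a)))"
    using far(1) by (intro integral_mono gap pt) auto
  also have "\<dots> = ?B + real (card I) ^ 2 * expectation (\<lambda>a. real (card (?far a)))"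
    using far(1) by (subst Bochner_Integration.integral_add) (auto simp: P.prob_space)
  also have "expectation (\<lambda>a. real (card (?far a))) \<le> real (card I) * (2 * exp (- R\<^sup>2 / 4))"
  proof -
    have "(\<Sum>k\<in>I. prob {a \<in> space P. R * \<sigma> < norm (a k - abar k)}) \<le> real (card I) * (2 * exp (- R\<^sup>2 / 4))"
      by (intro sum_bounded_above prob_far_le assms(3))
    then show ?thesis by (simp add: far(2))
  qed
  finally show ?thesis by (simp add: power2_eq_square power3_eq_cube mult_left_mono mult.assoc)
qed

text \<open>Summing \<open>prob_gap_edge_zero_le\<close> over all ordered pairs turns the
  probabilities on its right back into the expected number of gapped edges; the last error term
  collects one tail contribution per pair.\<close>

lemma expectation_num_edges_le:
  assumes "3 \<le> card I" "\<And>k. k \<in> I \<Longrightarrow> norm (abar k) \<le> 1" "R \<ge> 1"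
  shows "expectation (\<lambda>a. real (num_edges (convex hull (a ` I))))
    \<le> 2 * (exp 3 * (4 * (1 + 4 * sqrt ((1 + R * \<sigma>) / (\<sigma> / R))) + 2 * (real (card I) ^ 3 * exp (- R\<^sup>2 / 4)))
      + 4 * (real (card I) ^ 2 * exp (- R\<^sup>2 / 4)))"
proof -
  let ?\<tau> = "\<sigma> / R" and ?t = "exp (- R\<^sup>2 / 4)"
  have \<tau>: "?\<tau> > 0" using sigma_pos assms(3) by simp
  have pred: "Measurable.pred P (\<lambda>a. gap_edge \<tau> I a (fst p) (snd p))" if "p \<in> I \<times> I" for p \<tau>
    using that by (intro pred_gap_edge) auto
  note gap = expectation_card_eq_sum_prob[OF finite_cartesian_product[OF finite_I finite_I] pred]
  have "expectation (\<lambda>a. real (num_edges (convex hull (a ` I))))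
      \<le> expectation (\<lambda>a. 2 * real (card (gap_edges 0 a)))"
  proof (intro integral_mono integrable_num_edges integrable_mult_right gap(1))
    show "real (num_edges (convex hull (a ` I))) \<le> 2 * real (card (gap_edges 0 a))" for a
      using num_edges_le_gap_edges[of a] by linarith
  qed
  also have "\<dots> = 2 * (\<Sum>p\<in>I \<times> I. prob {a \<in> space P. gap_edge 0 I a (fst p) (snd p)})"
    by (simp add: gap(2))
  also have "(\<Sum>p\<in>I \<times> I. prob {a \<in> space P. gap_edge 0 I a (fst p) (snd p)})
      \<le> (\<Sum>p\<in>I \<times> I. exp 3 * prob {a \<in> space P. gap_edge ?\<tau> I a (fst p) (snd p)} + 4 * ?t)"
    by (intro sum_mono prob_gap_edge_zero_le assms(3)) auto
  also have "\<dots> = exp 3 * expectation (\<lambda>a. real (card (gap_edges ?\<tau> a))) + 4 * (real (card I) ^ 2 * ?t)"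
    by (simp add: gap(2) sum.distrib sum_distrib_left card_cartesian_product power2_eq_square)
  also have "expectation (\<lambda>a. real (card (gap_edges ?\<tau> a)))
      \<le> 4 * (1 + 4 * sqrt ((1 + R * \<sigma>) / ?\<tau>)) + 2 * (real (card I) ^ 3 * ?t)"
    using expectation_gap_edges_le[OF assms(1,2) _ \<tau>, of R] assms(3) by (simp add: mult.left_commute)
  finally show ?thesis by simp
qed

end

section \<open>Choice of the cutoff radius and of the constant\<close>

theorem mainTheorem4:
  shows "\<exists>C::real. C > 0 \<and>
    (\<forall>(n::nat) (\<sigma>::real) (abar :: nat \<Rightarrow> real ^ 2).
      n > 2 \<longrightarrow> \<sigma> > 0 \<longrightarrow> (\<forall>i\<in>{1..n}. norm (abar i) \<le> 1) \<longrightarrow>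
      (let P = (\<Pi>\<^sub>M i\<in>{1..n}. gauss2 (abar i) \<sigma>);
           X = (\<lambda>a. real (num_edges (convex hull (a ` {1..n}))))
       in integrable P X \<and>
          prob_space.expectation P X
            \<le> C * (root 4 (ln (real n)) / sqrt \<sigma> + sqrt (ln (real n)))))"
proof (intro exI[of _ "200 * exp 3"] conjI allI impI)
  fix n :: nat and \<sigma> :: real and abar :: "nat \<Rightarrow> real ^ 2"
  assume n: "n > 2" and \<sigma>: "\<sigma> > 0" and abar: "\<forall>i\<in>{1..n}. norm (abar i) \<le> 1"
  interpret gaussian_points "{1..n}" abar \<sigma> by unfold_locales (use \<sigma> in auto)
  define L where "L = ln (real n)"
  \<comment> \<open>The factor 12 makes \<open>exp (- R\<^sup>2 / 4)\<close> equal to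
    \<open>1 / real n ^ 3\<close>, which absorbs the powers of \<open>n\<close> in both error
    terms.\<close>
  define R where "R = sqrt (12 * L)"
  define s where "s = sqrt L"
  define r where "r = root 4 L / sqrt \<sigma>"
  \<comment> \<open>Here \<open>n \<ge> 3 \<ge> exp 1\<close>; additive constants can then be
    absorbed into \<open>s\<close>.\<close>
  have L: "L \<ge> 1"
  proof -
    have "exp 1 \<le> (3 :: real)" by (rule exp_le)
    then have "exp 1 \<le> real n" using n by linarith
    then show ?thesis unfolding L_def using n by (subst ln_ge_iff) auto
  qed
  have s: "s \<ge> 1" using L by (simp add: s_def)
  have R2: "R\<^sup>2 = 12 * L" using L by (simp add: R_def)
  \<comment> \<open>Rounding 12 up to 16; the bound \<open>4 * s\<close> later makes the root of
    \<open>4 * s / \<sigma>\<close> exactly \<open>2 * r\<close>.\<close>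
  have R4: "R \<le> 4 * s"
    unfolding R_def s_def using L by (intro real_le_lsqrt) (auto simp: power_mult_distrib)
  have R1: "R \<ge> 1" unfolding R_def using L by simp
  have e: "exp (- R\<^sup>2 / 4) = 1 / real n ^ 3"
  proof -
    have "exp (- R\<^sup>2 / 4) = exp (- (3 * L))" by (simp add: R2)
    also have "\<dots> = inverse (exp (real 3 * L))" by (simp add: exp_minus)
    also have "exp (real 3 * L) = real n ^ 3"
      unfolding L_def exp_of_nat_mult using n by simp
    finally show ?thesis by (simp add: inverse_eq_divide)
  qed
  have "real n ^ 3 * exp (- R\<^sup>2 / 4) = 1" unfolding e using n by simp
  moreover have "real n ^ 2 * exp (- R\<^sup>2 / 4) \<le> 1"
    unfolding e using n by (simp add: field_simps power2_eq_square power3_eq_cube)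
  moreover have "sqrt ((1 + R * \<sigma>) / (\<sigma> / R)) \<le> 2 * r + 4 * s"
  proof -
    \<comment> \<open>The two summands yield the two terms of the claim: \<open>2 * r\<close> from
      \<open>R / \<sigma>\<close> and \<open>4 * s\<close> from \<open>R\<^sup>2\<close>.\<close>
    have "(1 + R * \<sigma>) / (\<sigma> / R) = R / \<sigma> + R\<^sup>2"
      using \<sigma> R1 by (simp add: field_simps power2_eq_square)
    also have "sqrt \<dots> \<le> sqrt (R / \<sigma>) + sqrt (R\<^sup>2)"
      using \<sigma> R1 by (intro sqrt_add_le_add_sqrt) auto
    also have "sqrt (R\<^sup>2) = R" using R1 by simp
    also have "sqrt (R / \<sigma>) \<le> sqrt (4 * s / \<sigma>)"
      using R4 \<sigma> by (intro real_sqrt_le_mono divide_right_mono) auto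
    also have "sqrt (4 * s / \<sigma>) = 2 * r"
    proof -
      have "root 4 L = sqrt s" using real_root_mult_exp[of 2 2 L] by (simp add: s_def sqrt_def)
      then show ?thesis by (simp add: r_def real_sqrt_mult real_sqrt_divide)
    qed
    finally show ?thesis using R4 by simp
  qed
  ultimately have "2 * (exp 3 * (4 * (1 + 4 * sqrt ((1 + R * \<sigma>) / (\<sigma> / R))) + 2 * (real n ^ 3 * exp (- R\<^sup>2 / 4)))
      + 4 * (real n ^ 2 * exp (- R\<^sup>2 / 4)))
    \<le> 2 * (exp 3 * (4 * (1 + 4 * (2 * r + 4 * s)) + 2 * 1) + 4 * 1)"
    by (intro mult_left_mono add_mono) auto
  \<comment> \<open>The additive rest \<open>exp 3 * 12 + 8\<close> is at most
    \<open>exp 3 * 20\<close>, and \<open>s \<ge> 1\<close> moves it into the coefficient of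
    \<open>s\<close>: \<open>148 = 128 + 20\<close>.\<close>
  also have "\<dots> \<le> exp 3 * (64 * r + 148 * s)"
  proof -
    have "exp 3 * 20 \<le> exp 3 * (20 * s)" "(8 :: real) \<le> exp 3 * 8" using s by auto
    moreover have "2 * (exp 3 * (4 * (1 + 4 * (2 * r + 4 * s)) + 2 * 1) + 4 * 1)
        = exp 3 * (64 * r + 128 * s) + (exp 3 * 12 + 8)" by (simp add: algebra_simps)
    moreover have "exp 3 * (64 * r + 148 * s) = exp 3 * (64 * r + 128 * s) + exp 3 * (20 * s)"
      by (simp add: algebra_simps)
    ultimately show ?thesis by linarith
  qed
  also have "\<dots> \<le> 200 * exp 3 * (r + s)"
  proof -
    have "r \<ge> 0" using L \<sigma> by (simp add: r_def)
    then have "64 * r + 148 * s \<le> 200 * (r + s)" using s by simp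
    then show ?thesis by simp
  qed
  finally have "expectation (\<lambda>a. real (num_edges (convex hull (a ` {1..n})))) \<le> 200 * exp 3 * (r + s)"
    using expectation_num_edges_le[OF _ _ R1] n abar by force
  then show "let P = (\<Pi>\<^sub>M i\<in>{1..n}. gauss2 (abar i) \<sigma>);
           X = (\<lambda>a. real (num_edges (convex hull (a ` {1..n}))))
       in integrable P X \<and>
          prob_space.expectation P X
            \<le> 200 * exp 3 * (root 4 (ln (real n)) / sqrt \<sigma> + sqrt (ln (real n)))"
    using integrable_num_edges by (simp add: r_def s_def L_def)
qed simp

end
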